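(* Let $H_1$ and $H_2$ be maximal sectorial relations in a Hilbert space $\mathfrak{H}$, with $A_j^{1/2}$, $A_{js}^{1/2}$, $B_j$ ($j=1,2$) and $B_\oplus=B_1\oplus B_2$ as in the context, and let $\Phi$ be the linear relation from $\mathfrak{H}\times\mathfrak{H}$ to $\mathfrak{H}$ defined by $$\Phi=\left\{\{\{f_1,f_2\},f_1'+f_2'\}:\ \{f_j,f_j'\}\in A_j^{1/2},\ j=1,2\right\}.$$ The maximal sectorial relation $$\Phi^{**}(I+iB_\oplus)\Phi^*$$ is an extension of the relation $H_1+H_2$, which corresponds to the closed sectorial form $$((I+iB_1)A_{1s}^{1/2}h,A_{1s}^{1/2}k)+((I+iB_2)A_{2s}^{1/2}h,A_{2s}^{1/2}k),\quad h,k\in\operatorname{dom}A_1^{1/2}\cap\operatorname{dom}A_2^{1/2}.$$ Let $\mathfrak{E},\mathfrak{D},\mathfrak{F}$ be the closures in $\mathfrak{H}\times\mathfrak{H}$ of, respectively, $$\mathfrak{E}_0=\{\{A_{1s}^{1/2}f,A_{2s}^{1/2}f\}:f\in\operatorname{dom}H_1\cap\operatorname{dom}H_2\},$$ $$\mathfrak{D}_0=\{\{(I+iB_1)A_{1s}^{1/2}f,(I+iB_2)A_{2s}^{1/2}f\}:f\in\operatorname{dom}H_1\cap\operatorname{dom}H_2\},$$ $$\mathfrak{F}_0=\{\{A_{1s}^{1/2}h,A_{2s}^{1/2}h\}:h\in\operatorname{dom}A_1^{1/2}\cap\operatorname{dom}A_2^{1/2}\}.$$ Assume, in addition, that $\mathfrak{E}=\mathfrak{D}$.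 Then the following statements are equivalent: (i) $\Phi^{**}(I+iB_\oplus)\Phi^*$ is extremal (as a maximal sectorial extension of $H_1+H_2$); (ii) $\mathfrak{E}=\mathfrak{F}$.
   Context: Hilbert spaces are complex with inner product linear in the first entry; $\mathbf{B}(\mathfrak{H})$ is the set of bounded everywhere defined operators on $\mathfrak{H}$. A linear relation $T$ from $\mathfrak{H}$ to $\mathfrak{K}$ is a linear subspace of $\mathfrak{H}\times\mathfrak{K}$; operators are identified with their graphs. $\operatorname{dom}T$ is the set of first entries, $\ker T=\{f:\{f,0\}\in T\}$, $\operatorname{mul}T=\{k:\{0,k\}\in T\}$, $T^{-1}=\{\{g,f\}:\{f,g\}\in T\}$. The adjoint is $T^*=\{\{k,h\}\in\mathfrak{K}\times\mathfrak{H}:(k,f')=(h,f)\ \forall\{f,f'\}\in T\}$; $T^{**}$ is the closure of $T$. Products: $AB=\{\{f,h\}:\{f,g\}\in B,\ \{g,h\}\in A\text{ for some }g\}$; sums: $A+B=\{\{f,g+h\}:\{f,g\}\in A,\ \{f,h\}\in B\}$. A relation $S$ in $\mathfrak{H}$ is sectorial (vertex at the origin, semi-angle $\alpha\in[0,\pi/2)$) if $|\operatorname{Im}(h',h)|\le(\tan\alpha)\operatorname{Re}(h',h)$ for all $\{h,h'\}\in S$; it is maximal sectorial if it has no proper sectorial extension in $\mathfrak{H}$. If $S$ is sectorial, so is $S^{-1}$. For sectorial $S$ the form $\mathfrak{t}_S[\varphi,\psi]=(\varphi',\psi)$, $\{\varphi,\varphi'\},\{\psi,\psi'\}\in S$,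 $\operatorname{dom}\mathfrak{t}_S=\operatorname{dom}S$, is well defined, sectorial and closable. Closed (not necessarily densely defined) sectorial forms $\mathfrak{t}$ and maximal sectorial relations $H$ are in one-to-one correspondence via $H=\{\{\varphi,\varphi'\}:\varphi\in\operatorname{dom}\mathfrak{t},\ \mathfrak{t}[\varphi,\psi]=(\varphi',\psi)\ \forall\psi\in\operatorname{dom}\mathfrak{t}\}$. The Friedrichs extension $S_F$ is the maximal sectorial relation corresponding to the closure of $\mathfrak{t}_S$; the Krein extension is $S_K=((S^{-1})_F)^{-1}$. A maximal sectorial extension $H$ of a sectorial relation $S$ is extremal precisely when the closed sectorial form corresponding to $H$ is a restriction of the closed sectorial form corresponding to $S_K$. Pair data. For $j=1,2$ let $\mathfrak{t}_{H_j}$ be the closed sectorial form corresponding to $H_j$, and let $A_j$ be the nonnegative selfadjoint relation corresponding to the closed nonnegative form $\operatorname{Re}\mathfrak{t}_{H_j}$, where $(\operatorname{Re}\mathfrak{t})[h,k]=\tfrac12(\mathfrak{t}[h,k]+\overline{\mathfrak{t}[k,h]})$. Write $A_j=A_{js}\oplus(\{0\}\times\operatorname{mul}A_j)$, where $A_{js}=\{\{f,g\}\in A_j:g\perp\operatorname{mul}A_j\}$ is a nonnegative selfadjoint operator in $\mathfrak{H}\ominus\operatorname{mul}A_j$; $A_{js}^{1/2}$ is its nonnegative square root and $A_j^{1/2}=A_{js}^{1/2}\oplus(\{0\}\times\operatorname{mul}A_j)$. $B_j\in\mathbf{B}(\mathfrak{H})$ is the unique selfadjoint operator, zero on $\ker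 A_j\oplus\operatorname{mul}A_j$, such that $\mathfrak{t}_{H_j}[h,k]=((I+iB_j)A_{js}^{1/2}h,A_{js}^{1/2}k)$ for $h,k\in\operatorname{dom}\mathfrak{t}_{H_j}=\operatorname{dom}A_j^{1/2}$; then $H_j=A_j^{1/2}(I+iB_j)A_j^{1/2}$. $B_\oplus=B_1\oplus B_2$ is the orthogonal sum acting in $\mathfrak{H}\times\mathfrak{H}$. The sum $H_1+H_2$ is a sectorial relation with domain $\operatorname{dom}H_1\cap\operatorname{dom}H_2$. *)

theory Defs
  imports "HOL-Analysis.Analysis"
begin

section \<open>Complex Hilbert spaces\<close>

text \<open>The complex structure is put on top of the real Hilbert space structure of the library; the
  real inner product is the real part of the complex one, so that the norm is the one induced by
  the complex inner product. The inner product is linear in the first entry.\<close>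

class complex_hilbert = real_inner + complete_space +
  fixes scaleC :: "complex \<Rightarrow> 'a \<Rightarrow> 'a"  (infixr "*\<^sub>C" 75)
    and cinner :: "'a \<Rightarrow> 'a \<Rightarrow> complex"
  assumes scaleC_add_right: "c *\<^sub>C (x + y) = c *\<^sub>C x + c *\<^sub>C y"
    and scaleC_add_left: "(c + d) *\<^sub>C x = c *\<^sub>C x + d *\<^sub>C x"
    and scaleC_scaleC: "c *\<^sub>C (d *\<^sub>C x) = (c * d) *\<^sub>C x"
    and scaleC_of_real: "complex_of_real r *\<^sub>C x = r *\<^sub>R x"
    and cinner_add_left: "cinner (x + y) z = cinner x z + cinner y z"
    and cinner_scaleC_left: "cinner (c *\<^sub>C x) y = c * cinner x y"
    and cinner_commute: "cinner x y = cnj (cinner y x)"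
    and Re_cinner: "Re (cinner x y) = inner x y"

instantiation prod :: (complex_hilbert, complex_hilbert) complex_hilbert
begin

definition scaleC_prod_def: "c *\<^sub>C x = (c *\<^sub>C fst x, c *\<^sub>C snd x)"

definition cinner_prod_def: "cinner x y = cinner (fst x) (fst y) + cinner (snd x) (snd y)"

instance
proof
  fix c d :: complex and r :: real and x y z :: "'a \<times> 'b"
  show "c *\<^sub>C (x + y) = c *\<^sub>C x + c *\<^sub>C y"
    by (simp add: scaleC_prod_def scaleC_add_right)
  show "(c + d) *\<^sub>C x = c *\<^sub>C x + d *\<^sub>C x"
    by (simp add: scaleC_prod_def scaleC_add_left)
  show "c *\<^sub>C (d *\<^sub>C x) = (c * d) *\<^sub>C x"
    by (simp add: scaleC_prod_def scaleC_scaleC)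
  show "complex_of_real r *\<^sub>C x = r *\<^sub>R x"
    by (simp add: scaleC_prod_def scaleC_of_real scaleR_prod_def)
  show "cinner (x + y) z = cinner x z + cinner y z"
    by (simp add: cinner_prod_def cinner_add_left)
  show "cinner (c *\<^sub>C x) y = c * cinner x y"
    by (simp add: cinner_prod_def scaleC_prod_def cinner_scaleC_left distrib_left)
  show "cinner x y = cnj (cinner y x)"
    unfolding cinner_prod_def complex_cnj_add
    by (simp flip: cinner_commute)
  show "Re (cinner x y) = inner x y"
    by (simp add: cinner_prod_def inner_prod_def Re_cinner)
qed

end

definition csubspace :: "'a::complex_hilbert set \<Rightarrow> bool" where
  "csubspace M \<longleftrightarrow> 0 \<in> M \<and> (\<forall>x\<in>M. \<forall>y\<in>M. x + y \<in> M) \<and> (\<forall>c. \<forall>x\<in>M. c *\<^sub>C x \<in> M)"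

definition orth_compl :: "'a::complex_hilbert set \<Rightarrow> 'a set" where
  "orth_compl M = {x. \<forall>y\<in>M. cinner x y = 0}"

definition bounded_clinear :: "('a::complex_hilbert \<Rightarrow> 'b::complex_hilbert) \<Rightarrow> bool" where
  "bounded_clinear B \<longleftrightarrow> bounded_linear B \<and> (\<forall>c x. B (c *\<^sub>C x) = c *\<^sub>C B x)"

definition bounded_selfadjoint :: "('a::complex_hilbert \<Rightarrow> 'a) \<Rightarrow> bool" where
  "bounded_selfadjoint B \<longleftrightarrow> bounded_clinear B \<and> (\<forall>x y. cinner (B x) y = cinner x (B y))"


section \<open>Linear relations\<close>

text \<open>A linear relation from one space to another is a subset of the product satisfying
  \<^const>\<open>csubspace\<close>. Its domain and inverse are the library's \<^const>\<open>Domain\<close> and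
  \<^const>\<open>converse\<close>.\<close>

definition ker_rel :: "('a \<times> 'b::zero) set \<Rightarrow> 'a set" where
  "ker_rel T = {f. (f, 0) \<in> T}"

definition mul_rel :: "('a::zero \<times> 'b) set \<Rightarrow> 'b set" where
  "mul_rel T = {k. (0, k) \<in> T}"

definition adjoint_rel ::
    "('a::complex_hilbert \<times> 'b::complex_hilbert) set \<Rightarrow> ('b \<times> 'a) set" where
  "adjoint_rel T = {(k, h). \<forall>(f, f') \<in> T. cinner k f' = cinner h f}"

text \<open>The product \<open>AB\<close> applies \<open>B\<close> first, whereas \<open>relcomp\<close> takes its arguments in the order of
  application.\<close>

definition prod_rel :: "('b \<times> 'c) set \<Rightarrow> ('a \<times> 'b) set \<Rightarrow> ('a \<times> 'c) set" where
  "prod_rel A B = B O A"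

definition sum_rel :: "('a \<times> 'b::plus) set \<Rightarrow> ('a \<times> 'b) set \<Rightarrow> ('a \<times> 'b) set" where
  "sum_rel A B = {(f, g + h) | f g h. (f, g) \<in> A \<and> (f, h) \<in> B}"

definition graph_of :: "('a \<Rightarrow> 'b) \<Rightarrow> ('a \<times> 'b) set" where
  "graph_of B = {(x, B x) | x. True}"

definition app_rel :: "('a \<times> 'b) set \<Rightarrow> 'a \<Rightarrow> 'b" where
  "app_rel R f = (THE g. (f, g) \<in> R)"

text \<open>Nonnegative selfadjoint relations in the closed subspace \<open>M\<close>, regarded as a Hilbert space of
  its own: the adjoint formed in \<open>M\<close> is the part of the adjoint contained in \<open>M \<times> M\<close>.\<close>

definition nonneg_selfadjoint_in ::
    "'a::complex_hilbert set \<Rightarrow> ('a \<times> 'a) set \<Rightarrow> bool" where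
  "nonneg_selfadjoint_in M A \<longleftrightarrow>
     csubspace A \<and> A \<subseteq> M \<times> M \<and> adjoint_rel A \<inter> M \<times> M = A \<and>
     (\<forall>(h, h') \<in> A. Im (cinner h' h) = 0 \<and> 0 \<le> Re (cinner h' h))"

definition op_part :: "('a::complex_hilbert \<times> 'a) set \<Rightarrow> ('a \<times> 'a) set" where
  "op_part A = {(f, g). (f, g) \<in> A \<and> g \<in> orth_compl (mul_rel A)}"

definition is_nonneg_sqrt_in ::
    "'a::complex_hilbert set \<Rightarrow> ('a \<times> 'a) set \<Rightarrow> ('a \<times> 'a) set \<Rightarrow> bool" where
  "is_nonneg_sqrt_in M A R \<longleftrightarrow>
     nonneg_selfadjoint_in M R \<and> single_valued R \<and> prod_rel R R = A"

text \<open>The orthogonal sum \<open>R \<oplus> ({0} \<times> mul A)\<close>; this is \<open>A\<^sup>1\<^sup>/\<^sup>2\<close> when \<open>R\<close> is the nonnegative square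
  root of the operator part of \<open>A\<close>.\<close>

definition oplus_mul ::
    "('a::complex_hilbert \<times> 'a) set \<Rightarrow> ('a \<times> 'a) set \<Rightarrow> ('a \<times> 'a) set" where
  "oplus_mul R A = {(f, g + m) | f g m. (f, g) \<in> R \<and> m \<in> mul_rel A}"


section \<open>Sectorial relations\<close>

text \<open>A complex number lies in the closed sector with vertex at the origin and semi-angle \<open>\<alpha>\<close>.
  The condition on the real part follows from the other one if \<open>\<alpha> > 0\<close>; it is stated
  separately because for \<open>\<alpha> = 0\<close> the inequality alone would admit the negative half-axis.\<close>

definition in_sector :: "real \<Rightarrow> complex \<Rightarrow> bool" where
  "in_sector \<alpha> z \<longleftrightarrow> 0 \<le> Re z \<and> \<bar>Im z\<bar> \<le> tan \<alpha> * Re z"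

definition sectorial :: "('a::complex_hilbert \<times> 'a) set \<Rightarrow> bool" where
  "sectorial S \<longleftrightarrow> csubspace S \<and>
     (\<exists>\<alpha>. 0 \<le> \<alpha> \<and> \<alpha> < pi / 2 \<and> (\<forall>(h, h') \<in> S. in_sector \<alpha> (cinner h' h)))"

definition maximal_sectorial :: "('a::complex_hilbert \<times> 'a) set \<Rightarrow> bool" where
  "maximal_sectorial S \<longleftrightarrow> sectorial S \<and> (\<forall>T. sectorial T \<and> S \<subseteq> T \<longrightarrow> T = S)"


section \<open>Sectorial forms\<close>

text \<open>A form is a domain together with a function whose values outside the domain are
  irrelevant.\<close>

datatype 'a form = Form (fdom: "'a set") (fval: "'a \<Rightarrow> 'a \<Rightarrow> complex")

definition sectorial_form :: "'a::complex_hilbert form \<Rightarrow> bool" where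
  "sectorial_form t \<longleftrightarrow>
     csubspace (fdom t) \<and>
     (\<forall>h\<in>fdom t. \<forall>k\<in>fdom t. \<forall>l\<in>fdom t.
        fval t (h + k) l = fval t h l + fval t k l \<and>
        fval t l (h + k) = fval t l h + fval t l k) \<and>
     (\<forall>c. \<forall>h\<in>fdom t. \<forall>k\<in>fdom t.
        fval t (c *\<^sub>C h) k = c * fval t h k \<and>
        fval t h (c *\<^sub>C k) = cnj c * fval t h k) \<and>
     (\<exists>\<alpha>. 0 \<le> \<alpha> \<and> \<alpha> < pi / 2 \<and> (\<forall>h\<in>fdom t. in_sector \<alpha> (fval t h h)))"

definition form_converges ::
    "'a::complex_hilbert form \<Rightarrow> (nat \<Rightarrow> 'a) \<Rightarrow> 'a \<Rightarrow> bool" where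
  "form_converges t u h \<longleftrightarrow>
     (\<forall>n. u n \<in> fdom t) \<and> u \<longlonglongrightarrow> h \<and>
     (\<forall>e>0. \<exists>N. \<forall>m\<ge>N. \<forall>n\<ge>N. cmod (fval t (u n - u m) (u n - u m)) < e)"

definition closed_sectorial_form :: "'a::complex_hilbert form \<Rightarrow> bool" where
  "closed_sectorial_form t \<longleftrightarrow> sectorial_form t \<and>
     (\<forall>u h. form_converges t u h \<longrightarrow>
        h \<in> fdom t \<and> (\<lambda>n. fval t (u n - h) (u n - h)) \<longlonglongrightarrow> 0)"

text \<open>The limit below exists and does not depend on the sequences if the form is sectorial and
  closable.\<close>

definition form_closure :: "'a::complex_hilbert form \<Rightarrow> 'a form" where
  "form_closure t = Form {h. \<exists>u. form_converges t u h}
     (\<lambda>h k. THE z. \<forall>u v. form_converges t u h \<and> form_converges t v k \<longrightarrow>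
        (\<lambda>n. fval t (u n) (v n)) \<longlonglongrightarrow> z)"

definition form_restriction :: "'a form \<Rightarrow> 'a form \<Rightarrow> bool" where
  "form_restriction s t \<longleftrightarrow>
     fdom s \<subseteq> fdom t \<and> (\<forall>h\<in>fdom s. \<forall>k\<in>fdom s. fval s h k = fval t h k)"

definition real_part_form :: "'a form \<Rightarrow> 'a form" where
  "real_part_form t = Form (fdom t) (\<lambda>h k. (fval t h k + cnj (fval t k h)) / 2)"

definition rel_of_form :: "'a::complex_hilbert form \<Rightarrow> ('a \<times> 'a) set" where
  "rel_of_form t =
     {(\<phi>, \<phi>'). \<phi> \<in> fdom t \<and> (\<forall>\<psi>\<in>fdom t. fval t \<phi> \<psi> = cinner \<phi>' \<psi>)}"

definition corresponds :: "'a::complex_hilbert form \<Rightarrow> ('a \<times> 'a) set \<Rightarrow> bool" where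
  "corresponds t H \<longleftrightarrow> closed_sectorial_form t \<and> H = rel_of_form t"

text \<open>The form of a sectorial relation \<open>S\<close>; for sectorial \<open>S\<close> the value does not depend on the choice
  of \<open>\<phi>'\<close>.\<close>

definition form_of_rel :: "('a::complex_hilbert \<times> 'a) set \<Rightarrow> 'a form" where
  "form_of_rel S = Form (Domain S)
     (\<lambda>\<phi> \<psi>. THE z. \<exists>\<phi>'. (\<phi>, \<phi>') \<in> S \<and> z = cinner \<phi>' \<psi>)"


section \<open>Friedrichs, Krein and extremal extensions\<close>

definition friedrichs_ext :: "('a::complex_hilbert \<times> 'a) set \<Rightarrow> ('a \<times> 'a) set" where
  "friedrichs_ext S = rel_of_form (form_closure (form_of_rel S))"

definition krein_ext :: "('a::complex_hilbert \<times> 'a) set \<Rightarrow> ('a \<times> 'a) set" where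
  "krein_ext S = (friedrichs_ext (S\<inverse>))\<inverse>"

definition extremal_ext ::
    "('a::complex_hilbert \<times> 'a) set \<Rightarrow> ('a \<times> 'a) set \<Rightarrow> bool" where
  "extremal_ext S H \<longleftrightarrow>
     sectorial S \<and> maximal_sectorial H \<and> S \<subseteq> H \<and>
     (\<exists>t k. corresponds t H \<and> corresponds k (krein_ext S) \<and> form_restriction t k)"


section \<open>The data associated with a maximal sectorial relation\<close>

text \<open>\<open>t\<close> is the closed sectorial form corresponding to \<open>H\<close>, \<open>A\<close> the nonnegative selfadjoint
  relation corresponding to the real part of \<open>t\<close>, \<open>R\<close> the nonnegative square root of the operator
  part of \<open>A\<close>, and \<open>B\<close> the bounded selfadjoint operator, zero on \<open>ker A \<oplus> mul A\<close>, with
  \<open>t[h,k] = ((I + iB)Rh, Rk)\<close>. All of these are uniquely determined by \<open>H\<close> (up to the irrelevant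
  values of \<open>t\<close> outside its domain).\<close>

definition sectorial_data ::
    "('a::complex_hilbert \<times> 'a) set \<Rightarrow> 'a form \<Rightarrow> ('a \<times> 'a) set \<Rightarrow> ('a \<times> 'a) set
      \<Rightarrow> ('a \<Rightarrow> 'a) \<Rightarrow> bool" where
  "sectorial_data H t A R B \<longleftrightarrow>
     corresponds t H \<and>
     nonneg_selfadjoint_in UNIV A \<and> A = rel_of_form (real_part_form t) \<and>
     is_nonneg_sqrt_in (orth_compl (mul_rel A)) (op_part A) R \<and>
     bounded_selfadjoint B \<and>
     (\<forall>x \<in> ker_rel A. \<forall>y \<in> mul_rel A. B (x + y) = 0) \<and>
     fdom t = Domain (oplus_mul R A) \<and>
     (\<forall>h\<in>fdom t. \<forall>k\<in>fdom t.
        fval t h k = cinner (app_rel R h + \<i> *\<^sub>C B (app_rel R h)) (app_rel R k))"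

end

theory Submission
  imports Defs
begin

text \<open>With \<open>F h = (A\<^sub>1\<^sub>s\<^sup>1\<^sup>/\<^sup>2 h, A\<^sub>2\<^sub>s\<^sup>1\<^sup>/\<^sup>2 h)\<close>, which is a closed operator, and \<open>C = I + i B\<^sub>\<oplus>\<close>, the form of
  the theorem is \<open>(C F h, F k)\<close>. Since \<open>\<Phi>\<^sup>*\<close> consists of the pairs of \<open>h\<close> and \<open>(k\<^sub>1, k\<^sub>2)\<close> with
  \<open>{h, k\<^sub>j} \<in> A\<^sub>j\<^sup>1\<^sup>/\<^sup>2\<close>, the relation \<open>\<Phi>\<^sup>*\<^sup>* C \<Phi>\<^sup>*\<close> is the one corresponding to this form. If the
  closures of \<open>E\<^sub>0\<close> and \<open>D\<^sub>0 = C E\<^sub>0\<close> coincide, then \<open>C\<close> leaves \<open>E\<close> invariant, and the Krein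
  extension of \<open>S = H\<^sub>1 + H\<^sub>2\<close> corresponds to a form \<open>(C G h, G k)\<close> of the same kind, where \<open>G\<close> is the
  adjoint, formed in \<open>E\<close>, of the relation \<open>C F g \<mapsto> g'\<close>, \<open>{g, g'} \<in> S\<close>. For \<open>h\<close> in the domain of
  \<open>F\<close> the vector \<open>G h\<close> is the orthogonal projection of \<open>F h\<close> onto \<open>E\<close>. The real parts of the two forms
  at \<open>h\<close> are \<open>\<parallel>F h\<parallel>\<^sup>2\<close> and \<open>\<parallel>G h\<parallel>\<^sup>2\<close>, so that one form restricts the other if and only if
  \<open>F h \<in> E\<close> for all \<open>h\<close>.\<close>


section \<open>Complex Hilbert spaces\<close>

lemma scaleC_zero_left [simp]: "0 *\<^sub>C (x::'a::complex_hilbert) = 0"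
  using scaleC_of_real[of 0 x] by simp

lemma scaleC_minus1: "(-1) *\<^sub>C (x::'a::complex_hilbert) = - x"
  using scaleC_of_real[of "-1" x] by simp

lemma scaleC_zero_right [simp]: "c *\<^sub>C (0::'a::complex_hilbert) = 0"
  using scaleC_add_right[of c "0::'a" 0] by simp

lemma scaleC_minus_right: "c *\<^sub>C (- x::'a::complex_hilbert) = - (c *\<^sub>C x)"
  by (metis mult.commute scaleC_minus1 scaleC_scaleC)

lemma cinner_add_right: "cinner x (y + z) = cinner x y + cinner x (z::'a::complex_hilbert)"
  by (metis cinner_add_left cinner_commute complex_cnj_add)

lemma cinner_scaleC_right: "cinner x (c *\<^sub>C y) = cnj c * cinner x (y::'a::complex_hilbert)"
  by (metis cinner_scaleC_left cinner_commute complex_cnj_mult)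

lemma cinner_zero_left [simp]: "cinner 0 (x::'a::complex_hilbert) = 0"
  using cinner_add_left[of 0 0 x] by simp

lemma cinner_zero_right [simp]: "cinner (x::'a::complex_hilbert) 0 = 0"
  using cinner_add_right[of x 0 0] by simp

lemma cinner_minus_left: "cinner (- x) (y::'a::complex_hilbert) = - cinner x y"
  using cinner_add_left[of x "-x" y] by (simp add: eq_neg_iff_add_eq_0 add.commute)

lemma cinner_minus_right: "cinner x (- y::'a::complex_hilbert) = - cinner x y"
  using cinner_add_right[of x y "-y"] by (simp add: eq_neg_iff_add_eq_0 add.commute)

lemma cinner_diff_left: "cinner (x - y) (z::'a::complex_hilbert) = cinner x z - cinner y z"
  using cinner_add_left[of x "-y" z] by (simp add: cinner_minus_left)

lemma cinner_diff_right: "cinner x (y - z::'a::complex_hilbert) = cinner x y - cinner x z"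
  using cinner_add_right[of x y "-z"] by (simp add: cinner_minus_right)

lemmas cinner_simps = cinner_add_left cinner_add_right cinner_diff_left cinner_diff_right
  cinner_scaleC_left cinner_scaleC_right cinner_minus_left cinner_minus_right

lemma cinner_self: "cinner x (x::'a::complex_hilbert) = complex_of_real ((norm x)\<^sup>2)"
  by (rule complex_eqI)
    (use cinner_commute[of x x] in \<open>auto simp: Re_cinner power2_norm_eq_inner complex_eq_iff\<close>)

lemma cinner_self_eq_0 [simp]: "cinner x x = 0 \<longleftrightarrow> (x::'a::complex_hilbert) = 0"
  by (simp add: cinner_self)

lemma norm_scaleC: "norm (c *\<^sub>C (x::'a::complex_hilbert)) = cmod c * norm x"
proof -
  have "cinner (c *\<^sub>C x) (c *\<^sub>C x) = (c * cnj c) * cinner x x"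
    by (simp add: cinner_simps)
  then have "complex_of_real ((norm (c *\<^sub>C x))\<^sup>2) = complex_of_real ((cmod c * norm x)\<^sup>2)"
    by (simp add: cinner_self power_mult_distrib flip: complex_norm_square)
  then show ?thesis
    by (simp only: of_real_eq_iff) (simp add: power2_eq_iff_nonneg)
qed

lemma cinner_eq_0_commute: "cinner x y = 0 \<longleftrightarrow> cinner y (x::'a::complex_hilbert) = 0"
  using cinner_commute[of x y] cinner_commute[of y x] by auto

lemma orth_complD: "x \<in> orth_compl M \<Longrightarrow> y \<in> M \<Longrightarrow> cinner x y = 0"
  "x \<in> orth_compl M \<Longrightarrow> y \<in> M \<Longrightarrow> cinner y x = 0"
  by (auto simp: orth_compl_def cinner_eq_0_commute[of y x])

text \<open>A unimodular factor on \<open>x\<close> turns the complex inner product into its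
  modulus, which is then a real inner product and obeys the real Cauchy-Schwarz inequality.\<close>

lemma cmod_cinner_le: "cmod (cinner x y) \<le> norm x * norm (y::'a::complex_hilbert)"
proof (cases "cinner x y = 0")
  case False
  define c where "c = cnj (sgn (cinner x y))"
  have c: "cmod c = 1" using False by (simp add: c_def norm_sgn)
  have "c * cinner x y = complex_of_real (cmod (cinner x y))"
    using complex_norm_square[of "cinner x y"] False
    by (simp add: c_def sgn_div_norm scaleR_conv_of_real power2_eq_square field_simps)
  then have "cmod (cinner x y) = Re (cinner (c *\<^sub>C x) y)"
    by (simp add: cinner_scaleC_left)
  also have "\<dots> \<le> norm (c *\<^sub>C x) * norm y"
    by (simp add: Re_cinner norm_cauchy_schwarz)
  finally show ?thesis by (simp add: norm_scaleC c)
qed simp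

lemma scaleR_scaleC: "r *\<^sub>R x = complex_of_real r *\<^sub>C (x::'a::complex_hilbert)"
  by (simp add: scaleC_of_real)

text \<open>Sesquilinearity is bilinearity over the reals, so the limit and continuity rules for
  bounded bilinear maps apply.\<close>

lemma bounded_bilinear_cinner: "bounded_bilinear (cinner :: 'a::complex_hilbert \<Rightarrow> _)"
proof
  fix r :: real and x y z :: 'a
  show "cinner (r *\<^sub>R x) y = r *\<^sub>R cinner x y" "cinner x (r *\<^sub>R y) = r *\<^sub>R cinner x y"
    by (simp_all add: scaleR_scaleC cinner_simps scaleR_conv_of_real)
  show "\<exists>K. \<forall>a b::'a. norm (cinner a b) \<le> norm a * norm b * K"
    using cmod_cinner_le by (metis mult.right_neutral)
qed (simp_all add: cinner_simps)

lemmas tendsto_cinner [tendsto_intros] = bounded_bilinear.tendsto [OF bounded_bilinear_cinner]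
lemmas continuous_on_cinner [continuous_intros] =
  bounded_bilinear.continuous_on [OF bounded_bilinear_cinner]

lemma bounded_linear_scaleC: "bounded_linear (\<lambda>x::'a::complex_hilbert. c *\<^sub>C x)"
  by (rule bounded_linear_intro[where K = "cmod c"])
    (simp_all add: scaleC_add_right scaleR_scaleC scaleC_scaleC norm_scaleC mult.commute)

section \<open>Subspaces, orthogonal projection and double complements\<close>

lemma csubspaceD:
  assumes "csubspace M"
  shows "0 \<in> M" "x \<in> M \<Longrightarrow> y \<in> M \<Longrightarrow> x + y \<in> M" "x \<in> M \<Longrightarrow> c *\<^sub>C x \<in> M"
    "x \<in> M \<Longrightarrow> y \<in> M \<Longrightarrow> x - y \<in> M"
proof -
  show "x \<in> M \<Longrightarrow> y \<in> M \<Longrightarrow> x - y \<in> M"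
    using assms scaleC_minus1[of y] unfolding csubspace_def by (metis diff_conv_add_uminus)
qed (use assms in \<open>auto simp: csubspace_def\<close>)

lemma csubspace_closure:
  assumes "csubspace M"
  shows "csubspace (closure M)"
proof -
  have "x + y \<in> closure M" if xy: "x \<in> closure M" "y \<in> closure M" for x y
  proof -
    obtain u v where "\<forall>n. u n \<in> M" "u \<longlonglongrightarrow> x" "\<forall>n. v n \<in> M" "v \<longlonglongrightarrow> y"
      using xy by (auto simp: closure_sequential)
    then show ?thesis
      unfolding closure_sequential using assms
      by (intro exI[of _ "\<lambda>n. u n + v n"]) (auto intro: tendsto_add csubspaceD)
  qed
  moreover have "c *\<^sub>C x \<in> closure M" if x: "x \<in> closure M" for c x
  proof -
    obtain u where "\<forall>n. u n \<in> M" "u \<longlonglongrightarrow> x"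
      using x by (auto simp: closure_sequential)
    then show ?thesis
      unfolding closure_sequential using assms
      by (intro exI[of _ "\<lambda>n. c *\<^sub>C u n"])
        (auto intro: bounded_linear.tendsto[OF bounded_linear_scaleC] csubspaceD)
  qed
  moreover have "0 \<in> closure M"
    using assms closure_subset csubspaceD(1) by blast
  ultimately show ?thesis by (simp add: csubspace_def)
qed

text \<open>By the parallelogram law a minimizing sequence for the distance from \<open>x\<close> to
  \<open>N\<close> is Cauchy; its limit \<open>p\<close> is a nearest point, and varying
  \<open>p\<close> inside \<open>N\<close> gives orthogonality.\<close>

theorem projection:
  fixes N :: "'a::complex_hilbert set"
  assumes N: "csubspace N" and cl: "closed N"
  obtains p where "p \<in> N" "x - p \<in> orth_compl N"
proof -
  define d where "d = infdist x N"
  have ne: "N \<noteq> {}" using csubspaceD(1)[OF N] by auto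
  have d_le: "d\<^sup>2 \<le> (norm (x - y))\<^sup>2" if "y \<in> N" for y
    using infdist_le[OF that, of x] infdist_nonneg[of x N]
    by (auto simp: d_def dist_norm intro!: power_mono)
  have "\<exists>y\<in>N. (norm (x - y))\<^sup>2 < d\<^sup>2 + 1 / real (Suc n)" for n
  proof -
    have "d < sqrt (d\<^sup>2 + 1 / real (Suc n))"
      by (rule real_less_rsqrt) simp
    then obtain y where "y \<in> N" "dist x y < sqrt (d\<^sup>2 + 1 / real (Suc n))"
      unfolding d_def infdist_notempty[OF ne] using ne
      by (subst (asm) cINF_less_iff) auto
    moreover from this have "(dist x y)\<^sup>2 < (sqrt (d\<^sup>2 + 1 / real (Suc n)))\<^sup>2"
      by (intro power_strict_mono) auto
    ultimately show ?thesis by (auto simp: dist_norm)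
  qed
  then obtain y where yN: "\<And>n. y n \<in> N"
    and y: "\<And>n. (norm (x - y n))\<^sup>2 < d\<^sup>2 + 1 / real (Suc n)" by metis
  have par: "(norm (y n - y m))\<^sup>2 < 2 / real (Suc n) + 2 / real (Suc m)" for n m
  proof -
    have "(1/2) *\<^sub>R (y n + y m) \<in> N"
      using N yN by (simp add: scaleR_scaleC csubspaceD)
    note h = d_le[OF this]
    have "(norm (y n - y m))\<^sup>2 + 4 * (norm (x - (1/2) *\<^sub>R (y n + y m)))\<^sup>2
        = 2 * (norm (x - y n))\<^sup>2 + 2 * (norm (x - y m))\<^sup>2"
      by (simp add: power2_norm_eq_inner inner_simps inner_commute algebra_simps)
    with h y[of n] y[of m] show ?thesis by simp
  qed
  have "Cauchy y"
    unfolding Cauchy_def dist_norm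
  proof (intro allI impI)
    fix e :: real assume e: "0 < e"
    then obtain K where K: "4 / e\<^sup>2 < real K" using reals_Archimedean2 by blast
    have "norm (y m - y n) < e" if "m \<ge> K" "n \<ge> K" for m n
    proof -
      have *: "2 / real (Suc i) < e\<^sup>2 / 2" if "i \<ge> K" for i
      proof -
        have "4 / e\<^sup>2 < real (Suc i)" using K that by linarith
        then show ?thesis using e by (simp add: field_simps)
      qed
      have "(norm (y m - y n))\<^sup>2 < e\<^sup>2"
        using par[of m n] *[OF that(1)] *[OF that(2)] by simp
      then show ?thesis using e by (simp add: power_less_imp_less_base)
    qed
    then show "\<exists>M. \<forall>m\<ge>M. \<forall>n\<ge>M. norm (y m - y n) < e" by blast
  qed
  then obtain p where p: "y \<longlonglongrightarrow> p"
    using Cauchy_convergent_iff convergent_def by blast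
  have pN: "p \<in> N" using closed_sequentially[OF cl yN p] .
  have "(\<lambda>n. d\<^sup>2 + 1 / real (Suc n)) \<longlonglongrightarrow> d\<^sup>2 + 0"
    by (intro tendsto_intros LIMSEQ_inverse_real_of_nat[unfolded inverse_eq_divide])
  then have pd: "(norm (x - p))\<^sup>2 \<le> d\<^sup>2 + 0"
    by (rule LIMSEQ_le[OF tendsto_power[OF tendsto_norm[OF tendsto_diff[OF tendsto_const p]]]])
      (use y in \<open>auto intro: less_imp_le\<close>)
  have re: "inner (x - p) z = 0" if z: "z \<in> N" for z
  proof (cases "z = 0")
    case False
    \<comment> \<open>This \<open>t\<close> minimizes the distance from \<open>x - p\<close> to the
      real multiples of \<open>z\<close>; as \<open>p\<close> is already nearest, nothing can be
      gained and the inner product vanishes.\<close>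
    define t where "t = inner (x - p) z / (norm z)\<^sup>2"
    have "p + t *\<^sub>R z \<in> N" using N pN z by (simp add: scaleR_scaleC csubspaceD)
    from d_le[OF this] pd have "(norm (x - p))\<^sup>2 \<le> (norm (x - p - t *\<^sub>R z))\<^sup>2"
      unfolding diff_diff_eq by linarith
    also have "\<dots> = (norm (x - p))\<^sup>2 - 2 * t * inner (x - p) z + t\<^sup>2 * (norm z)\<^sup>2"
      unfolding power2_norm_eq_inner
      by (simp add: inner_simps inner_commute algebra_simps power2_eq_square)
    also have "\<dots> = (norm (x - p))\<^sup>2 - (inner (x - p) z)\<^sup>2 / (norm z)\<^sup>2"
      using False by (simp add: t_def field_simps power2_eq_square)
    finally show ?thesis using False by (simp add: divide_le_0_iff)
  qed simp
  have "cinner (x - p) z = 0" if z: "z \<in> N" for z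
  proof (rule complex_eqI)
    show "Re (cinner (x - p) z) = Re 0" using re[OF z] by (simp add: Re_cinner)
    \<comment> \<open>Testing with \<open>i z\<close> recovers the imaginary part of the inner
      product with \<open>z\<close>.\<close>
    have "Re (cinner (x - p) (\<i> *\<^sub>C z)) = 0"
      using re[of "\<i> *\<^sub>C z"] N z by (simp add: Re_cinner csubspaceD)
    then show "Im (cinner (x - p) z) = Im 0" by (simp add: cinner_scaleC_right)
  qed
  with pN show ?thesis using that by (auto simp: orth_compl_def)
qed

lemma csubspace_orth_compl: "csubspace (orth_compl M)"
  by (simp add: csubspace_def orth_compl_def cinner_simps)

lemma closed_orth_compl: "closed (orth_compl M)"
proof -
  have "orth_compl M = (\<Inter>y\<in>M. {x. cinner x y = 0})" by (auto simp: orth_compl_def)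
  moreover have "closed {x. cinner x y = 0}" for y :: 'a
    by (intro closed_Collect_eq continuous_intros)
  ultimately show ?thesis by (simp add: closed_INT)
qed

text \<open>For \<open>x\<close> in the double complement with projection \<open>p\<close> onto
  \<open>closure M\<close>, the vector \<open>x - p\<close> is orthogonal to both \<open>x\<close>
  and \<open>p\<close>, hence to itself.\<close>

lemma orth_compl_orth_compl:
  assumes "csubspace M"
  shows "orth_compl (orth_compl M) = closure M"
proof
  show "orth_compl (orth_compl M) \<subseteq> closure M"
  proof
    fix x assume x: "x \<in> orth_compl (orth_compl M)"
    obtain p where p: "p \<in> closure M" "x - p \<in> orth_compl (closure M)"
      using projection[OF csubspace_closure[OF assms] closed_closure] .
    then have xp: "x - p \<in> orth_compl M" using closure_subset by (auto simp: orth_compl_def)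
    have "cinner x (x - p) = 0" using x xp by (simp add: orth_compl_def)
    moreover have "cinner p (x - p) = 0"
      by (rule orth_complD[OF p(2,1)])
    ultimately have "cinner (x - p) (x - p) = 0" by (simp add: cinner_diff_left)
    then show "x \<in> closure M" using p by simp
  qed
  have "M \<subseteq> orth_compl (orth_compl M)"
    by (auto simp: orth_compl_def cinner_eq_0_commute)
  then show "closure M \<subseteq> orth_compl (orth_compl M)"
    by (rule closure_minimal[OF _ closed_orth_compl])
qed

section \<open>Linear relations: subspace structure and closedness\<close>

lemma csubspace_Domain:
  assumes "csubspace T"
  shows "csubspace (Domain T)"
  unfolding csubspace_def
proof (intro conjI ballI allI)
  show "0 \<in> Domain T" using csubspaceD(1)[OF assms] by (auto simp: zero_prod_def)
next
  fix x y assume "x \<in> Domain T" "y \<in> Domain T"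
  then show "x + y \<in> Domain T" using csubspaceD(2)[OF assms] by fastforce
next
  fix c x assume "x \<in> Domain T"
  then show "c *\<^sub>C x \<in> Domain T" using csubspaceD(3)[OF assms] by (fastforce simp: scaleC_prod_def)
qed

text \<open>Linearity is asked only on \<open>V\<close>, because operators appear later as total
  functions that are meaningful only on their domains.\<close>

lemma csubspace_linear_image:
  assumes V: "csubspace V"
    and add: "\<And>x y. x \<in> V \<Longrightarrow> y \<in> V \<Longrightarrow> f (x + y) = f x + f y"
    and scale: "\<And>c x. x \<in> V \<Longrightarrow> f (c *\<^sub>C x) = c *\<^sub>C f x"
  shows "csubspace (f ` V)"
  unfolding csubspace_def
proof (intro conjI ballI allI)
  have "f 0 = 0" using scale[of 0 0] csubspaceD(1)[OF V] by simp
  then show "0 \<in> f ` V" using csubspaceD(1)[OF V] by force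
next
  fix x y assume "x \<in> f ` V" "y \<in> f ` V"
  then show "x + y \<in> f ` V" using add csubspaceD(2)[OF V] by (metis (no_types, lifting) image_iff)
next
  fix c x assume "x \<in> f ` V"
  then show "c *\<^sub>C x \<in> f ` V" using scale csubspaceD(3)[OF V] by (metis (no_types, lifting) image_iff)
qed

lemma closed_adjoint_rel: "closed (adjoint_rel T)"
proof -
  have "adjoint_rel T = (\<Inter>(f, f')\<in>T. {x. cinner (fst x) f' = cinner (snd x) f})"
    by (auto simp: adjoint_rel_def)
  also have "closed \<dots>"
    by (intro closed_INT ballI) (auto intro!: closed_Collect_eq continuous_intros)
  finally show ?thesis .
qed

lemma Domain_sum_rel: "Domain (sum_rel S T) = Domain S \<inter> Domain T"
  by (auto simp: sum_rel_def)

lemma csubspace_sum_rel: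
  assumes "csubspace S" "csubspace T"
  shows "csubspace (sum_rel S T)"
  unfolding csubspace_def
proof (intro conjI ballI allI)
  show "0 \<in> sum_rel S T"
    using csubspaceD(1)[OF assms(1)] csubspaceD(1)[OF assms(2)]
    by (force simp: sum_rel_def zero_prod_def)
next
  fix x y assume "x \<in> sum_rel S T" "y \<in> sum_rel S T"
  then obtain f g h f' g' h' where xy: "x = (f, g + h)" "y = (f', g' + h')"
    and "(f, g) \<in> S" "(f, h) \<in> T" "(f', g') \<in> S" "(f', h') \<in> T"
    by (auto simp: sum_rel_def)
  then have "(f + f', g + g') \<in> S" "(f + f', h + h') \<in> T"
    using csubspaceD(2)[OF assms(1), of "(f, g)" "(f', g')"]
      csubspaceD(2)[OF assms(2), of "(f, h)" "(f', h')"] by simp_all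
  moreover have "x + y = (f + f', (g + g') + (h + h'))" by (simp add: xy)
  ultimately show "x + y \<in> sum_rel S T" unfolding sum_rel_def by blast
next
  fix c x assume "x \<in> sum_rel S T"
  then obtain f g h where x: "x = (f, g + h)" and "(f, g) \<in> S" "(f, h) \<in> T"
    by (auto simp: sum_rel_def)
  then have "(c *\<^sub>C f, c *\<^sub>C g) \<in> S" "(c *\<^sub>C f, c *\<^sub>C h) \<in> T"
    using csubspaceD(3)[OF assms(1), of "(f, g)" c] csubspaceD(3)[OF assms(2), of "(f, h)" c]
    by (simp_all add: scaleC_prod_def)
  moreover have "c *\<^sub>C x = (c *\<^sub>C f, c *\<^sub>C g + c *\<^sub>C h)"
    by (simp add: x scaleC_prod_def scaleC_add_right)
  ultimately show "c *\<^sub>C x \<in> sum_rel S T" unfolding sum_rel_def by blast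
qed


section \<open>Bounded operators with positive definite real part\<close>

lemma bounded_clinearD:
  assumes "bounded_clinear A"
  shows "bounded_linear A" "A (x + y) = A x + A y" "A (x - y) = A x - A y"
    "A (c *\<^sub>C x) = c *\<^sub>C A x" "A 0 = 0" "A (- x) = - A x"
  using assms linear_simps[of A] by (auto simp: bounded_clinear_def)

lemma bounded_selfadjointD:
  assumes "bounded_selfadjoint B"
  shows "bounded_clinear B" "cinner (B x) y = cinner x (B y)"
  using assms by (auto simp: bounded_selfadjoint_def)

lemma bounded_clinear_id_plus_i:
  assumes "bounded_selfadjoint B"
  shows "bounded_clinear (\<lambda>x. x + \<i> *\<^sub>C B x)"
proof -
  note B = bounded_clinearD[OF bounded_selfadjointD(1)[OF assms]]
  have "bounded_linear (\<lambda>x. x + \<i> *\<^sub>C B x)"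
    by (intro bounded_linear_add bounded_linear_ident
        bounded_linear_compose[OF bounded_linear_scaleC B(1)])
  then show ?thesis
    by (simp add: bounded_clinear_def B scaleC_add_right scaleC_scaleC mult.commute)
qed

lemma Im_cinner_selfadjoint:
  assumes "bounded_selfadjoint B"
  shows "Im (cinner (B x) x) = 0"
  using bounded_selfadjointD(2)[OF assms, of x x] cinner_commute[of x "B x"]
  by (simp add: complex_eq_iff)

text \<open>\<open>(B x, x)\<close> is real, so \<open>i B\<close> contributes only to the imaginary
  part.\<close>

lemma Re_cinner_id_plus_i:
  assumes "bounded_selfadjoint B"
  shows "Re (cinner (x + \<i> *\<^sub>C B x) x) = (norm x)\<^sup>2"
  using Im_cinner_selfadjoint[OF assms] by (simp add: cinner_simps cinner_self)

text \<open>Coercivity combined with Cauchy-Schwarz. The bound later pulls convergence of the images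
  under \<open>I + i B\<close> back to the arguments.\<close>

lemma norm_le_norm_id_plus_i:
  assumes "bounded_selfadjoint B"
  shows "norm x \<le> norm (x + \<i> *\<^sub>C B x)"
proof (cases "x = 0")
  case False
  have "norm x * norm x \<le> cmod (cinner (x + \<i> *\<^sub>C B x) x)"
    using Re_cinner_id_plus_i[OF assms, of x] complex_Re_le_cmod
    by (metis power2_eq_square)
  also have "\<dots> \<le> norm (x + \<i> *\<^sub>C B x) * norm x" by (rule cmod_cinner_le)
  finally show ?thesis using False by simp
qed simp

lemma bounded_selfadjoint_map_prod:
  assumes "bounded_selfadjoint B1" "bounded_selfadjoint B2"
  shows "bounded_selfadjoint (map_prod B1 B2)"
proof -
  note B1 = bounded_clinearD[OF bounded_selfadjointD(1)[OF assms(1)]]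
  note B2 = bounded_clinearD[OF bounded_selfadjointD(1)[OF assms(2)]]
  have "bounded_linear (\<lambda>x. (B1 (fst x), B2 (snd x)))"
    by (intro bounded_linear_Pair bounded_linear_compose[OF B1(1)] bounded_linear_compose[OF B2(1)]
        bounded_linear_fst bounded_linear_snd)
  moreover have "map_prod B1 B2 = (\<lambda>x. (B1 (fst x), B2 (snd x)))" by auto
  ultimately show ?thesis
    using bounded_selfadjointD(2)[OF assms(1)] bounded_selfadjointD(2)[OF assms(2)]
    by (simp add: bounded_selfadjoint_def bounded_clinear_def cinner_prod_def scaleC_prod_def
        B1(4) B2(4))
qed

text \<open>With \<open>\<pi>\<close> the projection onto \<open>N\<close>, the solution is the
  fixed point of \<open>x - e \<pi> (C x - w)\<close>, which contracts \<open>N\<close> for small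
  \<open>e\<close> because \<open>C\<close> is bounded and \<open>Re (C x, x)\<close> is the squared
  norm.\<close>

lemma lax_milgram:
  fixes B :: "'c::complex_hilbert \<Rightarrow> 'c"
  assumes B: "bounded_selfadjoint B" and N: "csubspace N" and cl: "closed N"
  obtains x where "x \<in> N" "x + \<i> *\<^sub>C B x - w \<in> orth_compl N"
proof -
  define C where "C = (\<lambda>x. x + \<i> *\<^sub>C B x)"
  have "bounded_clinear C" using bounded_clinear_id_plus_i[OF B] by (simp add: C_def)
  note C = bounded_clinearD[OF this]
  obtain M0 where "\<And>x. norm (C x) \<le> norm x * M0" "0 < M0"
    using bounded_linear.pos_bounded[OF C(1)] by auto
  \<comment> \<open>Adding 1 ensures \<open>M \<ge> 1\<close>, hence \<open>e \<le> 1\<close> and a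
    real contraction constant below.\<close>
  define M where "M = M0 + 1"
  have M: "norm (C x) \<le> M * norm x" "1 \<le> M" for x
    using \<open>\<And>x. norm (C x) \<le> norm x * M0\<close>[of x] \<open>0 < M0\<close>
    by (simp_all add: M_def algebra_simps add_increasing)
  \<comment> \<open>Expanding the square gives the factor \<open>1 - 2 e + e^2 M^2\<close>, which
    this choice minimizes, with value \<open>1 - e\<close>.\<close>
  define e where "e = 1 / M\<^sup>2"
  have e: "0 < e" "e \<le> 1" "e * M\<^sup>2 = 1" using M(2) by (simp_all add: e_def)
  have "\<forall>u. \<exists>p. p \<in> N \<and> u - p \<in> orth_compl N" using projection[OF N cl] by metis
  then obtain \<pi> where \<pi>: "\<And>u. \<pi> u \<in> N" "\<And>u. u - \<pi> u \<in> orth_compl N" by metis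
  define f where "f = (\<lambda>x. x - e *\<^sub>R \<pi> (C x - w))"
  have contr: "dist (f x) (f y) \<le> sqrt (1 - e) * dist x y" if xy: "x \<in> N" "y \<in> N" for x y
  proof -
    define d where "d = x - y"
    define q where "q = \<pi> (C x - w) - \<pi> (C y - w)"
    have dN: "d \<in> N" and qN: "q \<in> N" using N xy \<pi> by (simp_all add: d_def q_def csubspaceD)
    \<comment> \<open>Since \<open>\<pi>\<close> comes from a choice, \<open>q\<close> is identified
      as the projection of \<open>C d\<close> onto \<open>N\<close> through orthogonality rather
      than through linearity of \<open>\<pi>\<close>.\<close>
    have "cinner (C d - q) z = 0" if "z \<in> N" for z
    proof -
      have "C d - q = (C x - w - \<pi> (C x - w)) - (C y - w - \<pi> (C y - w))"
        by (simp add: d_def q_def C(3))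
      then show ?thesis
        using orth_complD(1)[OF \<pi>(2)[of "C x - w"] that] orth_complD(1)[OF \<pi>(2)[of "C y - w"] that]
        by (simp only: cinner_diff_left[of _ "C y - w - \<pi> (C y - w)"] diff_self)
    qed
    then have Cq: "inner (C d) z = inner q z" if "z \<in> N" for z
      using that by (metis Re_cinner cinner_diff_left eq_iff_diff_eq_0)
    have qd: "inner q d = (norm d)\<^sup>2"
      using Cq[OF dN] Re_cinner_id_plus_i[OF B, of d] by (simp add: C_def Re_cinner)
    have "norm q * norm q \<le> norm (C d) * norm q"
      using Cq[OF qN] norm_cauchy_schwarz[of "C d" q]
      by (simp add: power2_norm_eq_inner flip: power2_eq_square)
    then have "norm q \<le> M * norm d"
      using M(1)[of d] M(2) by (cases "q = 0") auto
    then have "(norm q)\<^sup>2 \<le> (M * norm d)\<^sup>2" by (rule power_mono) simp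
    then have "e\<^sup>2 * (norm q)\<^sup>2 \<le> e\<^sup>2 * (M * norm d)\<^sup>2" by (rule mult_left_mono) simp
    also have "\<dots> = e * (e * M\<^sup>2) * (norm d)\<^sup>2" by (simp add: power2_eq_square)
    also have "\<dots> = e * (norm d)\<^sup>2" by (simp only: e mult_1_right)
    finally have q2: "e\<^sup>2 * (norm q)\<^sup>2 \<le> e * (norm d)\<^sup>2" .
    have "(norm (d - e *\<^sub>R q))\<^sup>2 = (norm d)\<^sup>2 - 2 * e * inner q d + e\<^sup>2 * (norm q)\<^sup>2"
      unfolding power2_norm_eq_inner
      by (simp add: inner_simps inner_commute algebra_simps power2_eq_square)
    also have "\<dots> \<le> (1 - e) * (norm d)\<^sup>2" using q2 by (simp add: qd algebra_simps)
    also have "\<dots> = (sqrt (1 - e) * norm d)\<^sup>2" using e by (simp add: power_mult_distrib)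
    finally have "norm (d - e *\<^sub>R q) \<le> sqrt (1 - e) * norm d"
      by (rule power2_le_imp_le) (use e in simp)
    moreover have "f x - f y = d - e *\<^sub>R q"
      by (simp add: f_def d_def q_def scaleR_diff_right)
    ultimately show ?thesis by (simp add: dist_norm d_def)
  qed
  have "\<exists>!x\<in>N. f x = x"
  proof (rule Banach_fix[of N "sqrt (1 - e)"])
    show "complete N" using cl by (simp add: complete_eq_closed)
    show "N \<noteq> {}" using csubspaceD(1)[OF N] by auto
    show "f ` N \<subseteq> N"
      using N \<pi> by (auto simp: f_def scaleR_scaleC csubspaceD)
  qed (use e contr in auto)
  then obtain x where x: "x \<in> N" "f x = x" by auto
  then have "\<pi> (C x - w) = 0" using e by (simp add: f_def)
  then show ?thesis using that[OF x(1)] \<pi>(2)[of "C x - w"] by (simp add: C_def)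
qed


section \<open>Forms factored through a closed operator\<close>

lemma sectorial_form_Re_cauchy_schwarz:
  assumes t: "sectorial_form t" and x: "x \<in> fdom t" and y: "y \<in> fdom t"
  shows "(Re (fval t x y + fval t y x))\<^sup>2 \<le> 4 * Re (fval t x x) * Re (fval t y y)"
proof -
  define s where "s = Re (fval t x y + fval t y x)"
  define a where "a = Re (fval t x x)"
  define b where "b = Re (fval t y y)"
  \<comment> \<open>The real part of the form at \<open>x + r y\<close> is a nonnegative quadratic
    polynomial in the real variable \<open>r\<close>; the claim says that its discriminant is not
    positive.\<close>
  have pos: "0 \<le> a + r * s + r\<^sup>2 * b" for r :: real
  proof -
    let ?c = "complex_of_real r"
    have D: "csubspace (fdom t)" using t by (simp add: sectorial_form_def)
    have yr: "?c *\<^sub>C y \<in> fdom t" and xy: "x + ?c *\<^sub>C y \<in> fdom t"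
      using D x y by (simp_all add: csubspaceD)
    have add: "fval t (h + k) l = fval t h l + fval t k l"
      "fval t l (h + k) = fval t l h + fval t l k"
      if "h \<in> fdom t" "k \<in> fdom t" "l \<in> fdom t" for h k l
      using t that by (simp_all add: sectorial_form_def)
    have scale: "fval t (c *\<^sub>C h) k = c * fval t h k" "fval t h (c *\<^sub>C k) = cnj c * fval t h k"
      if "h \<in> fdom t" "k \<in> fdom t" for c h k
      using t that by (simp_all add: sectorial_form_def)
    have "0 \<le> Re (fval t (x + ?c *\<^sub>C y) (x + ?c *\<^sub>C y))"
      using t xy by (auto simp: sectorial_form_def in_sector_def)
    also have "fval t (x + ?c *\<^sub>C y) (x + ?c *\<^sub>C y)
        = fval t x x + ?c * fval t x y + ?c * fval t y x + ?c * ?c * fval t y y"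
      using x y yr xy by (simp add: add scale algebra_simps)
    also have "Re \<dots> = a + r * s + r\<^sup>2 * b"
      by (simp add: a_def b_def s_def algebra_simps power2_eq_square)
    finally show ?thesis .
  qed
  have b: "0 \<le> b" using t y by (auto simp: b_def sectorial_form_def in_sector_def)
  have "s\<^sup>2 \<le> 4 * a * b"
  proof (cases "b = 0")
    case True
    have "s = 0"
    proof (rule ccontr)
      assume "s \<noteq> 0"
      \<comment> \<open>At this point the polynomial, affine because \<open>b = 0\<close>, takes the
        value -1.\<close>
      with pos[of "- (a + 1) / s"] True show False by simp
    qed
    then show ?thesis using True by simp
  next
    case False
    \<comment> \<open>The vertex of the parabola.\<close>
    with b pos[of "- s / (2 * b)"] show ?thesis
      by (simp add: field_simps power2_eq_square)
  qed
  then show ?thesis by (simp add: s_def a_def b_def)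
qed

text \<open>Expanding the form at \<open>u n = x n + h\<close> leaves the cross term
  \<open>s n\<close>, whose square is bounded by a multiple of the real part at \<open>x n\<close>
  and so tends to 0.\<close>

lemma sectorial_form_Re_tendsto:
  assumes t: "sectorial_form t" and u: "\<And>n. u n \<in> fdom t" and h: "h \<in> fdom t"
    and lim: "(\<lambda>n. fval t (u n - h) (u n - h)) \<longlonglongrightarrow> 0"
  shows "(\<lambda>n. Re (fval t (u n) (u n))) \<longlonglongrightarrow> Re (fval t h h)"
proof -
  have D: "csubspace (fdom t)" using t by (simp add: sectorial_form_def)
  define x where "x = (\<lambda>n. u n - h)"
  have x: "x n \<in> fdom t" for n using D u h by (simp add: x_def csubspaceD)
  define s where "s = (\<lambda>n. Re (fval t (x n) h + fval t h (x n)))"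
  have Q: "(\<lambda>n. Re (fval t (x n) (x n))) \<longlonglongrightarrow> 0"
    using tendsto_Re[OF lim] by (simp add: x_def)
  then have "(\<lambda>n. 4 * Re (fval t (x n) (x n)) * Re (fval t h h)) \<longlonglongrightarrow> 0"
    by (intro tendsto_mult_left_zero tendsto_mult_right_zero)
  then have "(\<lambda>n. (s n)\<^sup>2) \<longlonglongrightarrow> 0"
    by (rule real_tendsto_sandwich[rotated 2, OF tendsto_const])
      (auto simp: s_def intro!: always_eventually sectorial_form_Re_cauchy_schwarz[OF t x h, simplified])
  then have "s \<longlonglongrightarrow> 0" by simp
  then have "(\<lambda>n. Re (fval t (x n) (x n)) + s n + Re (fval t h h)) \<longlonglongrightarrow> 0 + 0 + Re (fval t h h)"
    by (intro tendsto_add Q tendsto_const)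
  moreover have "fval t (u n) (u n) = fval t (x n) (x n) + (fval t (x n) h + fval t h (x n)) + fval t h h" for n
  proof -
    have "fval t (x n + h) (x n + h) = fval t (x n) (x n + h) + fval t h (x n + h)"
      using t x h D by (simp add: sectorial_form_def csubspaceD)
    also have "\<dots> = fval t (x n) (x n) + fval t (x n) h + (fval t h (x n) + fval t h h)"
      using t x h by (simp add: sectorial_form_def)
    finally show ?thesis by (simp add: x_def)
  qed
  ultimately show ?thesis by (simp add: s_def)
qed

text \<open>A closed operator is encoded as a total function \<open>F\<close> together with a domain
  \<open>D\<close> over which its graph is closed. The locale serves twice: for the form of the sum
  and for the form of the Krein extension.\<close>

locale factored_form =
  fixes D :: "'a::complex_hilbert set" and F :: "'a \<Rightarrow> 'b::complex_hilbert" and B :: "'b \<Rightarrow> 'b"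
  assumes D: "csubspace D"
    and F_add: "\<And>h k. h \<in> D \<Longrightarrow> k \<in> D \<Longrightarrow> F (h + k) = F h + F k"
    and F_scale: "\<And>c h. h \<in> D \<Longrightarrow> F (c *\<^sub>C h) = c *\<^sub>C F h"
    and closed_graph: "closed ((\<lambda>h. (h, F h)) ` D)"
    and B: "bounded_selfadjoint B"
begin

definition C :: "'b \<Rightarrow> 'b" where
  "C x = x + \<i> *\<^sub>C B x"

definition q :: "'a form" where
  "q = Form D (\<lambda>h k. cinner (C (F h)) (F k))"

lemma q_simps [simp]: "fdom q = D" "fval q h k = cinner (C (F h)) (F k)"
  by (simp_all add: q_def)

lemmas C = bounded_clinearD[OF bounded_clinear_id_plus_i[OF B], folded C_def]
lemmas B_clinear = bounded_clinearD[OF bounded_selfadjointD(1)[OF B]]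
lemmas Re_C = Re_cinner_id_plus_i[OF B, folded C_def]
lemmas norm_C_ge = norm_le_norm_id_plus_i[OF B, folded C_def]
lemmas tendsto_C = bounded_linear.tendsto[OF C(1)]

lemma F_zero: "F 0 = 0"
  using F_scale[OF csubspaceD(1)[OF D], of 0] by simp

lemma F_diff: "h \<in> D \<Longrightarrow> k \<in> D \<Longrightarrow> F (h - k) = F h - F k"
  using F_add[of "h - k" k] D by (simp add: csubspaceD)

lemma csubspace_image: "csubspace V \<Longrightarrow> V \<subseteq> D \<Longrightarrow> csubspace ((\<lambda>h. (h, F h)) ` V)"
  by (rule csubspace_linear_image) (auto simp: F_add F_scale scaleC_prod_def subset_iff)

lemma graph_limit:
  assumes "\<And>n. u n \<in> D" "u \<longlonglongrightarrow> h" "(\<lambda>n. F (u n)) \<longlonglongrightarrow> e"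
  shows "h \<in> D" "F h = e"
proof -
  have "(h, e) \<in> (\<lambda>h. (h, F h)) ` D"
    by (rule closed_sequentially[OF closed_graph, of "\<lambda>n. (u n, F (u n))"])
      (use assms in \<open>auto intro: tendsto_Pair\<close>)
  then show "h \<in> D" "F h = e" by auto
qed

lemma cmod_C_bound:
  obtains K where "0 < K" "\<And>x. cmod (cinner (C x) x) \<le> K * (norm x)\<^sup>2"
proof -
  obtain K where K: "0 < K" "\<And>x. norm (C x) \<le> norm x * K"
    using bounded_linear.pos_bounded[OF C(1)] by auto
  have "cmod (cinner (C x) x) \<le> K * (norm x)\<^sup>2" for x
    using order_trans[OF cmod_cinner_le mult_right_mono[OF K(2), of "norm x" x]]
    by (simp add: power2_eq_square mult.commute mult.left_commute)
  with K(1) show ?thesis by (rule that)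
qed

lemma norm_sq_le_cmod: "(norm x)\<^sup>2 \<le> cmod (cinner (C x) x)"
  using complex_Re_le_cmod[of "cinner (C x) x"] by (simp add: Re_C)

text \<open>The real part of \<open>(C x, x)\<close> is the squared norm of \<open>x\<close>, and
  its imaginary part is at most \<open>K\<close> times that, where \<open>K\<close> bounds
  \<open>B\<close>; so the tangent of the semi-angle may be \<open>K\<close>.\<close>

lemma in_sector_C: obtains \<alpha> where "0 \<le> \<alpha>" "\<alpha> < pi / 2" "\<And>x. in_sector \<alpha> (cinner (C x) x)"
proof -
  obtain K where K: "0 < K" "\<And>x. norm (B x) \<le> norm x * K"
    using bounded_linear.pos_bounded[OF B_clinear(1)] by auto
  have "\<bar>Im (cinner (C x) x)\<bar> \<le> K * (norm x)\<^sup>2" for x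
  proof -
    have "Im (cinner (C x) x) = Re (cinner (B x) x)"
      by (simp add: C_def cinner_simps cinner_self)
    also have "\<bar>\<dots>\<bar> \<le> cmod (cinner (B x) x)" by (rule abs_Re_le_cmod)
    also have "\<dots> \<le> norm (B x) * norm x" by (rule cmod_cinner_le)
    also have "\<dots> \<le> K * (norm x)\<^sup>2"
      using mult_right_mono[OF K(2), of "norm x" x]
      by (simp add: power2_eq_square mult.commute mult.left_commute)
    finally show ?thesis .
  qed
  then have "in_sector (arctan K) (cinner (C x) x)" for x
    by (simp add: in_sector_def Re_C tan_arctan)
  moreover have "0 \<le> arctan K" "arctan K < pi / 2" using K arctan_ubound by auto
  ultimately show ?thesis using that by blast
qed

section \<open>Sectoriality and closedness of the form\<close>

lemma sectorial_form_q: "sectorial_form q"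
proof -
  obtain \<alpha> where "0 \<le> \<alpha>" "\<alpha> < pi / 2" "\<And>x. in_sector \<alpha> (cinner (C x) x)"
    using in_sector_C by blast
  then have "\<exists>\<alpha>. 0 \<le> \<alpha> \<and> \<alpha> < pi / 2 \<and> (\<forall>h\<in>D. in_sector \<alpha> (cinner (C (F h)) (F h)))"
    by blast
  then show ?thesis
    unfolding sectorial_form_def q_simps
    by (intro conjI D) (simp_all add: F_add F_scale C(2,4) cinner_simps)
qed

text \<open>The modulus of \<open>(C x, x)\<close> lies between the squared norm of \<open>x\<close>
  and a constant multiple of it. Thus convergence in the form \<open>q\<close> amounts to
  convergence in the graph norm of \<open>F\<close>.\<close>

lemma Cauchy_iff_C:
  "(\<forall>e>0. \<exists>N. \<forall>m\<ge>N. \<forall>n\<ge>N. cmod (cinner (C (y n - y m)) (y n - y m)) < e) \<longleftrightarrow> Cauchy y"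
proof
  assume L: "\<forall>e>0. \<exists>N. \<forall>m\<ge>N. \<forall>n\<ge>N. cmod (cinner (C (y n - y m)) (y n - y m)) < e"
  show "Cauchy y"
    unfolding Cauchy_def
  proof (intro allI impI)
    fix e :: real assume e: "0 < e"
    then obtain N where N: "\<forall>m\<ge>N. \<forall>n\<ge>N. cmod (cinner (C (y n - y m)) (y n - y m)) < e\<^sup>2"
      using L[rule_format, of "e\<^sup>2"] by auto
    have "dist (y m) (y n) < e" if "m \<ge> N" "n \<ge> N" for m n
    proof -
      have "(norm (y m - y n))\<^sup>2 < e\<^sup>2"
        by (rule le_less_trans[OF norm_sq_le_cmod N[rule_format, OF that(2,1)]])
      then show ?thesis using e by (simp add: dist_norm power_less_imp_less_base)
    qed
    then show "\<exists>N. \<forall>m\<ge>N. \<forall>n\<ge>N. dist (y m) (y n) < e" by blast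
  qed
next
  assume R: "Cauchy y"
  obtain K where K: "0 < K" "\<And>x. cmod (cinner (C x) x) \<le> K * (norm x)\<^sup>2"
    using cmod_C_bound by blast
  show "\<forall>e>0. \<exists>N. \<forall>m\<ge>N. \<forall>n\<ge>N. cmod (cinner (C (y n - y m)) (y n - y m)) < e"
  proof (intro allI impI)
    fix e :: real assume e: "0 < e"
    then obtain N where N: "\<forall>m\<ge>N. \<forall>n\<ge>N. dist (y m) (y n) < sqrt (e / K)"
      using metric_CauchyD[OF R, of "sqrt (e / K)"] K by auto
    have "cmod (cinner (C (y n - y m)) (y n - y m)) < e" if "m \<ge> N" "n \<ge> N" for m n
    proof -
      have "(norm (y n - y m))\<^sup>2 < (sqrt (e / K))\<^sup>2"
        using N that by (intro power_strict_mono) (auto simp: dist_norm)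
      then have "K * (norm (y n - y m))\<^sup>2 < e"
        using e K by (simp add: field_simps)
      with K(2) show ?thesis by (rule le_less_trans)
    qed
    then show "\<exists>N. \<forall>m\<ge>N. \<forall>n\<ge>N. cmod (cinner (C (y n - y m)) (y n - y m)) < e"
      by blast
  qed
qed

lemma form_converges_q_iff:
  "form_converges q u h \<longleftrightarrow> (\<forall>n. u n \<in> D) \<and> u \<longlonglongrightarrow> h \<and> Cauchy (\<lambda>n. F (u n))"
proof (cases "\<forall>n. u n \<in> D")
  case True
  then show ?thesis
    by (simp add: form_converges_def F_diff flip: Cauchy_iff_C[of "\<lambda>n. F (u n)"])
next
  case False
  then show ?thesis unfolding form_converges_def q_simps by blast
qed

lemma closed_sectorial_form_q: "closed_sectorial_form q"
  unfolding closed_sectorial_form_def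
proof (intro conjI allI impI sectorial_form_q)
  fix u h assume "form_converges q u h"
  then have u: "\<And>n. u n \<in> D" "u \<longlonglongrightarrow> h" and "Cauchy (\<lambda>n. F (u n))"
    by (auto simp: form_converges_q_iff)
  then obtain e where e: "(\<lambda>n. F (u n)) \<longlonglongrightarrow> e"
    using Cauchy_convergent_iff convergent_def by blast
  note he = graph_limit[OF u e]
  then show "h \<in> fdom q" by simp
  have "(\<lambda>n. F (u n - h)) \<longlonglongrightarrow> 0"
    using LIM_zero[OF e] by (simp add: F_diff u he)
  then have "(\<lambda>n. cinner (C (F (u n - h))) (F (u n - h))) \<longlonglongrightarrow> cinner (C 0) 0"
    by (intro tendsto_cinner tendsto_C)
  then show "(\<lambda>n. fval q (u n - h) (u n - h)) \<longlonglongrightarrow> 0" by simp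
qed

section \<open>The relation of the form: maximality and core\<close>

lemma rel_q_iff:
  "(h, \<phi>) \<in> rel_of_form q \<longleftrightarrow> h \<in> D \<and> (\<forall>k\<in>D. cinner (C (F h)) (F k) = cinner \<phi> k)"
  by (simp add: rel_of_form_def)

lemma csubspace_rel_q: "csubspace (rel_of_form q)"
  unfolding csubspace_def
  by (auto simp: rel_q_iff zero_prod_def scaleC_prod_def csubspaceD[OF D] F_zero F_add F_scale C
      cinner_simps)

lemmas csubspace_Domain_rel_q = csubspace_Domain[OF csubspace_rel_q]

lemma Domain_rel_q: "Domain (rel_of_form q) \<subseteq> D"
  by (auto simp: rel_q_iff)

lemma sectorial_rel_q: "sectorial (rel_of_form q)"
proof -
  obtain \<alpha> where "0 \<le> \<alpha>" "\<alpha> < pi / 2" and \<alpha>: "\<And>x. in_sector \<alpha> (cinner (C x) x)"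
    using in_sector_C by blast
  moreover have "in_sector \<alpha> (cinner h' h)" if "(h, h') \<in> rel_of_form q" for h h'
    using \<alpha>[of "F h"] that by (simp add: rel_q_iff)
  ultimately show ?thesis
    using csubspace_rel_q unfolding sectorial_def by blast
qed

text \<open>The form plus the inner product is a coercive form on the graph of \<open>F\<close>, which is a closed
  subspace of the product space.\<close>

lemma lax_milgram_graph:
  assumes "bounded_selfadjoint B'"
  obtains h where "h \<in> D"
    "\<And>k. k \<in> D \<Longrightarrow> cinner h k + cinner (F h + \<i> *\<^sub>C B' (F h)) (F k) = cinner w (k, F k)"
proof -
  note B' = bounded_clinearD[OF bounded_selfadjointD(1)[OF assms]]
  \<comment> \<open>\<open>B'\<close> is extended by zero on the first component, so that the
    coercive form on the graph becomes the inner product of \<open>h\<close> and \<open>k\<close>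
    plus the form with \<open>I + i B'\<close>.\<close>
  have sa: "bounded_selfadjoint (\<lambda>x::'a \<times> 'b. (0, B' (snd x)))"
    unfolding bounded_selfadjoint_def bounded_clinear_def
    using bounded_selfadjointD(2)[OF assms]
    by (auto simp: cinner_prod_def scaleC_prod_def B'
        intro!: bounded_linear_Pair bounded_linear_zero bounded_linear_compose[OF B'(1)]
          bounded_linear_snd)
  obtain x where "x \<in> (\<lambda>h. (h, F h)) ` D"
    and x: "x + \<i> *\<^sub>C (0, B' (snd x)) - w \<in> orth_compl ((\<lambda>h. (h, F h)) ` D)"
    by (rule lax_milgram[OF sa csubspace_image[OF D order_refl] closed_graph])
  then obtain h where h: "h \<in> D" "x = (h, F h)" by auto
  have "cinner h k + cinner (F h + \<i> *\<^sub>C B' (F h)) (F k) = cinner w (k, F k)" if "k \<in> D" for k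
    using orth_complD(1)[OF x, of "(k, F k)"] that
    by (simp add: h cinner_diff_left cinner_prod_def scaleC_prod_def algebra_simps)
  with h(1) show ?thesis by (rule that)
qed

text \<open>The case \<open>w = (f, 0)\<close> of the preceding lemma. This range condition is what
  yields both maximality and the core property.\<close>

lemma surj_one_plus_rel_q:
  obtains h where "(h, f - h) \<in> rel_of_form q"
proof -
  obtain h where h: "h \<in> D"
    "\<And>k. k \<in> D \<Longrightarrow> cinner h k + cinner (F h + \<i> *\<^sub>C B (F h)) (F k) = cinner (f, 0) (k, F k)"
    using lax_milgram_graph[OF B, of "(f, 0)"] by blast
  then have "(h, f - h) \<in> rel_of_form q"
    by (simp add: rel_q_iff C_def cinner_prod_def cinner_diff_left eq_diff_eq add.commute)
  then show ?thesis by (rule that)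
qed

text \<open>For \<open>(h, h')\<close> in a sectorial extension, surjectivity gives a pair of the
  relation with the same sum \<open>h + h'\<close>. The difference of the two pairs is
  \<open>(x, - x)\<close>, and sectoriality forces \<open>x = 0\<close>.\<close>

lemma maximal_sectorial_rel_q: "maximal_sectorial (rel_of_form q)"
  unfolding maximal_sectorial_def
proof (intro conjI allI impI sectorial_rel_q)
  fix T :: "('a \<times> 'a) set" assume T: "sectorial T \<and> rel_of_form q \<subseteq> T"
  have "(h, h') \<in> rel_of_form q" if hT: "(h, h') \<in> T" for h h'
  proof -
    obtain g where g: "(g, h + h' - g) \<in> rel_of_form q" by (rule surj_one_plus_rel_q)
    have "(h, h') - (g, h + h' - g) \<in> T"
      using T g hT by (intro csubspaceD(4)) (auto simp: sectorial_def)
    then have "(h - g, - (h - g)) \<in> T" by simp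
    then have "0 \<le> Re (cinner (- (h - g)) (h - g))"
      using T by (auto simp: sectorial_def in_sector_def)
    then have "norm (h - g) = 0"
      unfolding cinner_minus_left cinner_self by simp
    then show ?thesis using g by simp
  qed
  then show "T = rel_of_form q" using T by auto
qed

lemma corresponds_q: "corresponds q (rel_of_form q)"
  by (simp add: corresponds_def closed_sectorial_form_q)

text \<open>A vector of the graph that is orthogonal to the restriction of the graph to the domain of
  the relation is represented by some \<open>z\<close> with respect to the adjoint form, and then \<open>z = 0\<close>
  because \<open>1\<close> plus the relation is surjective.\<close>

lemma Domain_rel_q_core:
  assumes "h \<in> D"
  obtains u where "\<And>n. u n \<in> Domain (rel_of_form q)" "u \<longlonglongrightarrow> h" "(\<lambda>n. F (u n)) \<longlonglongrightarrow> F h"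
proof -
  let ?N = "(\<lambda>h. (h, F h)) ` D"
  let ?W = "(\<lambda>h. (h, F h)) ` Domain (rel_of_form q)"
  have W: "csubspace ?W" by (rule csubspace_image[OF csubspace_Domain_rel_q Domain_rel_q])
  have WN: "closure ?W \<subseteq> ?N"
    using Domain_rel_q by (intro closure_minimal closed_graph image_mono)
  obtain p where p: "p \<in> closure ?W" "(h, F h) - p \<in> orth_compl (closure ?W)"
    by (rule projection[OF csubspace_closure[OF W] closed_closure])
  define w where "w = (h, F h) - p"
  have wN: "w \<in> ?N"
    unfolding w_def using assms p(1) WN
    by (intro csubspaceD(4)[OF csubspace_image[OF D order_refl]]) auto
  \<comment> \<open>The adjoint of \<open>I + i B\<close> is \<open>I - i B\<close>, so the adjoint
    form is represented with \<open>- B\<close>.\<close>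
  have "bounded_selfadjoint (\<lambda>x. - B x)"
    using B bounded_selfadjointD(2)[OF B]
    by (auto simp: bounded_selfadjoint_def bounded_clinear_def cinner_simps scaleC_minus_right
        intro: bounded_linear_minus)
  then obtain k where k: "k \<in> D"
    "\<And>g. g \<in> D \<Longrightarrow> cinner k g + cinner (F k + \<i> *\<^sub>C (- B (F k))) (F g) = cinner w (g, F g)"
    using lax_milgram_graph[of "\<lambda>x. - B x" w] by blast
  \<comment> \<open>With this test vector the orthogonality of \<open>w\<close> to
    \<open>(g, F g)\<close> becomes \<open>(k, k) = 0\<close>.\<close>
  obtain g where g: "(g, k - g) \<in> rel_of_form q" by (rule surj_one_plus_rel_q)
  then have g': "g \<in> Domain (rel_of_form q)" by (rule DomainI)
  then have gD: "g \<in> D" using Domain_rel_q by blast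
  have "(g, F g) \<in> ?W" using g' by (rule imageI)
  then have "cinner w (g, F g) = 0"
    unfolding w_def by (intro orth_complD(1)[OF p(2)] subsetD[OF closure_subset])
  with k(2)[OF gD] have "cinner g k + cinner (F g) (F k + \<i> *\<^sub>C (- B (F k))) = 0"
    by (metis cinner_commute complex_cnj_add complex_cnj_zero)
  moreover have "cinner (F g) (F k + \<i> *\<^sub>C (- B (F k))) = cinner (C (F g)) (F k)"
    using bounded_selfadjointD(2)[OF B, of "F g" "F k"] by (simp add: C_def cinner_simps)
  moreover have "cinner (C (F g)) (F k) = cinner (k - g) k"
    using g k(1) by (simp add: rel_q_iff)
  ultimately have "k = 0" by (simp add: cinner_diff_left)
  then have "cinner w x = 0" if "x \<in> ?N" for x
    using k(2) that by (auto simp: F_zero B_clinear)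
  then have "w = 0" using wN cinner_self_eq_0 by blast
  then have "(h, F h) \<in> closure ?W" using p(1) by (simp add: w_def)
  then obtain x where x: "\<forall>n. x n \<in> ?W" "x \<longlonglongrightarrow> (h, F h)"
    by (auto simp: closure_sequential)
  show ?thesis
  proof (rule that[of "\<lambda>n. fst (x n)"])
    show "fst (x n) \<in> Domain (rel_of_form q)" for n using x(1)[rule_format, of n] by auto
    show "(\<lambda>n. fst (x n)) \<longlonglongrightarrow> h" using tendsto_fst[OF x(2)] by simp
    have "F (fst (x n)) = snd (x n)" for n using x(1)[rule_format, of n] by auto
    then show "(\<lambda>n. F (fst (x n))) \<longlonglongrightarrow> F h" using tendsto_snd[OF x(2)] by simp
  qed
qed

text \<open>\<open>t\<close> is given only through its relation, which fixes the diagonal of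
  \<open>t\<close> on the domain of the relation. The core sequences converge in \<open>t\<close> as
  well, and closedness of \<open>t\<close> carries the real part over to all of
  \<open>D\<close>.\<close>

lemma corresponding_form_extends:
  assumes t: "corresponds t (rel_of_form q)" and h: "h \<in> D"
  shows "h \<in> fdom t" "Re (fval t h h) = (norm (F h))\<^sup>2"
proof -
  have cl: "closed_sectorial_form t" and eq: "rel_of_form t = rel_of_form q"
    using t by (simp_all add: corresponds_def)
  have agree: "x \<in> fdom t" "fval t x x = cinner (C (F x)) (F x)"
    if x: "x \<in> Domain (rel_of_form q)" for x
  proof -
    obtain x' where x': "(x, x') \<in> rel_of_form q" using x by auto
    then have "(x, x') \<in> rel_of_form t" by (simp add: eq)
    with x' show "x \<in> fdom t" "fval t x x = cinner (C (F x)) (F x)"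
      unfolding rel_q_iff by (auto simp: rel_of_form_def)
  qed
  obtain u where u: "\<And>n. u n \<in> Domain (rel_of_form q)" "u \<longlonglongrightarrow> h" "(\<lambda>n. F (u n)) \<longlonglongrightarrow> F h"
    using Domain_rel_q_core[OF h] by blast
  have uD: "u n \<in> D" for n using u(1) Domain_rel_q by blast
  have "form_converges q u h"
    using uD u LIMSEQ_imp_Cauchy[OF u(3)] by (simp add: form_converges_q_iff)
  then have "form_converges t u h"
    using u by (simp add: form_converges_def agree csubspaceD[OF csubspace_Domain_rel_q])
  with cl have h: "h \<in> fdom t" and lim: "(\<lambda>n. fval t (u n - h) (u n - h)) \<longlonglongrightarrow> 0"
    by (auto simp: closed_sectorial_form_def)
  then show "h \<in> fdom t" by simp
  have "(\<lambda>n. Re (fval t (u n) (u n))) \<longlonglongrightarrow> Re (fval t h h)"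
    using cl h lim u(1) agree(1)
    by (intro sectorial_form_Re_tendsto) (auto simp: closed_sectorial_form_def)
  moreover have "(\<lambda>n. Re (fval t (u n) (u n))) \<longlonglongrightarrow> (norm (F h))\<^sup>2"
    using u by (simp add: agree Re_C tendsto_power tendsto_norm)
  ultimately show "Re (fval t h h) = (norm (F h))\<^sup>2" by (rule LIMSEQ_unique)
qed

end


section \<open>The Krein extension of a restriction\<close>

locale restricted_form = factored_form +
  fixes S :: "('a \<times> 'a) set"
  assumes csubspace_S: "csubspace S" and S_subset: "S \<subseteq> rel_of_form q"
begin

definition E :: "'b set" where
  "E = closure (F ` Domain S)"

text \<open>As a relation \<open>K\<close> sends \<open>f'\<close> to \<open>F f\<close>. The form
  of the inverse of \<open>S\<close> is \<open>(K \<phi>, C K \<psi>)\<close>, so closing that form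
  amounts to closing \<open>K\<close>.\<close>

definition K :: "('a \<times> 'b) set" where
  "K = (\<lambda>(f, f'). (f', F f)) ` S"

definition G :: "('a \<times> 'b) set" where
  "G = {(h, e). e \<in> E \<and> (\<forall>(g, g')\<in>S. cinner e (C (F g)) = cinner h g')}"

lemma cinner_G: "(h, e) \<in> G \<Longrightarrow> (g, g') \<in> S \<Longrightarrow> cinner e (C (F g)) = cinner h g'"
  by (auto simp: G_def)

lemma S_D: "(f, f') \<in> S \<Longrightarrow> f \<in> D"
  and cinner_S: "(f, f') \<in> S \<Longrightarrow> h \<in> D \<Longrightarrow> cinner f' h = cinner (C (F f)) (F h)"
  using S_subset by (auto simp: rel_q_iff subset_iff)

lemma cinner_S': "(f, f') \<in> S \<Longrightarrow> h \<in> D \<Longrightarrow> cinner h f' = cinner (F h) (C (F f))"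
  using cinner_S by (metis cinner_commute)

lemma Domain_S: "csubspace (Domain S)" "Domain S \<subseteq> D"
  using csubspace_Domain[OF csubspace_S] S_D by auto

lemma F_in_E: "(f, f') \<in> S \<Longrightarrow> F f \<in> E"
  unfolding E_def by (auto intro!: subsetD[OF closure_subset])

lemma csubspace_E: "csubspace E"
  unfolding E_def using Domain_S
  by (intro csubspace_closure csubspace_linear_image) (auto simp: F_add F_scale subset_iff)

lemma closed_E: "closed E" by (simp add: E_def)

section \<open>Closability and closure of the form of the inverse\<close>

lemma csubspace_K: "csubspace K"
  unfolding K_def
  by (rule csubspace_linear_image[OF csubspace_S])
    (auto simp: F_add F_scale S_D scaleC_prod_def)

lemma closure_K_E: "(\<phi>, e) \<in> closure K \<Longrightarrow> e \<in> E"
proof -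
  have "closure K \<subseteq> UNIV \<times> E"
    by (intro closure_minimal closed_Times closed_UNIV closed_E) (auto simp: K_def F_in_E)
  then show "(\<phi>, e) \<in> closure K \<Longrightarrow> e \<in> E" by auto
qed

lemma cinner_closure_K:
  assumes "(\<phi>, e) \<in> closure K" "h \<in> D"
  shows "cinner \<phi> h = cinner (C e) (F h)"
proof -
  have "closure K \<subseteq> {x. cinner (fst x) h = cinner (C (snd x)) (F h)}"
    by (intro closure_minimal closed_Collect_eq continuous_intros
        bounded_linear.continuous_on[OF C(1)])
      (use assms(2) in \<open>auto simp: K_def cinner_S\<close>)
  then show ?thesis using assms(1) by auto
qed

text \<open>If \<open>(0, x)\<close> lies in \<open>closure K\<close>, then \<open>C x\<close> is
  orthogonal to \<open>E\<close> while \<open>x\<close> lies in \<open>E\<close>, and positivity of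
  the real part of \<open>C\<close> gives \<open>x = 0\<close>.\<close>

lemma closure_K_unique:
  assumes "(\<phi>, e) \<in> closure K" "(\<phi>, d) \<in> closure K"
  shows "e = d"
proof -
  have 0: "(0, e - d) \<in> closure K"
    using csubspaceD(4)[OF csubspace_closure[OF csubspace_K] assms] by simp
  have "E \<subseteq> {x. cinner (C (e - d)) x = 0}"
    unfolding E_def using Domain_S(2) cinner_closure_K[OF 0]
    by (intro closure_minimal closed_Collect_eq continuous_intros) auto
  then have "cinner (C (e - d)) (e - d) = 0" using closure_K_E[OF 0] by auto
  then show ?thesis using Re_C[of "e - d"] by simp
qed

lemma K_subset: "(f, f') \<in> S \<Longrightarrow> (f', F f) \<in> closure K"
  using closure_subset by (force simp: K_def)

text \<open>\<open>(f, \<psi>) = (F f, C F g)\<close>, and \<open>F f\<close> depends only on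
  \<open>\<phi>\<close> because \<open>closure K\<close> is single valued; hence the definite
  description has exactly one candidate.\<close>

lemma form_of_inverse:
  shows "fdom (form_of_rel (S\<inverse>)) = Range S"
    and "(f, \<phi>) \<in> S \<Longrightarrow> (g, \<psi>) \<in> S \<Longrightarrow>
      fval (form_of_rel (S\<inverse>)) \<phi> \<psi> = cinner (F f) (C (F g))"
proof -
  show "fdom (form_of_rel (S\<inverse>)) = Range S" by (simp add: form_of_rel_def)
  assume f: "(f, \<phi>) \<in> S" and g: "(g, \<psi>) \<in> S"
  have "F k = F f" if "(k, \<phi>) \<in> S" for k
    using closure_K_unique[OF K_subset K_subset] f that by blast
  then have "cinner k \<psi> = cinner (F f) (C (F g))" if "(k, \<phi>) \<in> S" for k
    using that g cinner_S' S_D by metis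
  then show "fval (form_of_rel (S\<inverse>)) \<phi> \<psi> = cinner (F f) (C (F g))"
    unfolding form_of_rel_def form.sel using f by (intro the_equality) auto
qed

text \<open>Up to conjugation the form at a difference is \<open>(C x, x)\<close> with
  \<open>x\<close> the difference of the vectors \<open>F (f n)\<close>, so
  \<open>Cauchy_iff_C\<close> and completeness apply.\<close>

lemma form_converges_inverse_iff:
  "form_converges (form_of_rel (S\<inverse>)) u \<phi> \<longleftrightarrow>
    (\<exists>f e. (\<forall>n. (f n, u n) \<in> S) \<and> u \<longlonglongrightarrow> \<phi> \<and> (\<lambda>n. F (f n)) \<longlonglongrightarrow> e)"
proof -
  have *: "form_converges (form_of_rel (S\<inverse>)) u \<phi> \<longleftrightarrow> u \<longlonglongrightarrow> \<phi> \<and> Cauchy (\<lambda>n. F (f n))"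
    if f: "\<forall>n. (f n, u n) \<in> S" for f
  proof -
    have "cmod (fval (form_of_rel (S\<inverse>)) (u n - u m) (u n - u m))
        = cmod (cinner (C (F (f n) - F (f m))) (F (f n) - F (f m)))" for m n
    proof -
      have fD: "f i \<in> D" for i using f S_D by blast
      have "(f n - f m, u n - u m) \<in> S"
        using csubspaceD(4)[OF csubspace_S, of "(f n, u n)" "(f m, u m)"] f by simp
      then have "fval (form_of_rel (S\<inverse>)) (u n - u m) (u n - u m)
          = cinner (F (f n - f m)) (C (F (f n - f m)))"
        by (simp add: form_of_inverse)
      then show ?thesis
        by (simp add: F_diff fD) (metis cinner_commute complex_mod_cnj)
    qed
    then show ?thesis
      using f Cauchy_iff_C[of "\<lambda>n. F (f n)"]
      by (auto simp: form_converges_def form_of_inverse)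
  qed
  show ?thesis
  proof
    assume L: "form_converges (form_of_rel (S\<inverse>)) u \<phi>"
    then have "\<forall>n. \<exists>f. (f, u n) \<in> S" by (auto simp: form_converges_def form_of_inverse)
    then obtain f where f: "\<forall>n. (f n, u n) \<in> S" by metis
    with L *[OF f] show "\<exists>f e. (\<forall>n. (f n, u n) \<in> S) \<and> u \<longlonglongrightarrow> \<phi> \<and> (\<lambda>n. F (f n)) \<longlonglongrightarrow> e"
      unfolding Cauchy_convergent_iff convergent_def by blast
  next
    assume "\<exists>f e. (\<forall>n. (f n, u n) \<in> S) \<and> u \<longlonglongrightarrow> \<phi> \<and> (\<lambda>n. F (f n)) \<longlonglongrightarrow> e"
    then show "form_converges (form_of_rel (S\<inverse>)) u \<phi>"
      using * by (auto intro: LIMSEQ_imp_Cauchy)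
  qed
qed

lemma closure_K_iff:
  "(\<phi>, e) \<in> closure K \<longleftrightarrow>
    (\<exists>f u. (\<forall>n. (f n, u n) \<in> S) \<and> u \<longlonglongrightarrow> \<phi> \<and> (\<lambda>n. F (f n)) \<longlonglongrightarrow> e)"
proof
  assume "(\<phi>, e) \<in> closure K"
  then obtain x where x: "\<forall>n. x n \<in> K" "x \<longlonglongrightarrow> (\<phi>, e)" by (auto simp: closure_sequential)
  have "\<exists>f. (f, fst (x n)) \<in> S \<and> F f = snd (x n)" for n
    using x(1)[rule_format, of n] by (auto simp: K_def)
  then obtain f where "\<And>n. (f n, fst (x n)) \<in> S" "\<And>n. F (f n) = snd (x n)" by metis
  then show "\<exists>f u. (\<forall>n. (f n, u n) \<in> S) \<and> u \<longlonglongrightarrow> \<phi> \<and> (\<lambda>n. F (f n)) \<longlonglongrightarrow> e"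
    using tendsto_fst[OF x(2)] tendsto_snd[OF x(2)]
    by (intro exI[of _ f] exI[of _ "\<lambda>n. fst (x n)"]) simp
next
  assume "\<exists>f u. (\<forall>n. (f n, u n) \<in> S) \<and> u \<longlonglongrightarrow> \<phi> \<and> (\<lambda>n. F (f n)) \<longlonglongrightarrow> e"
  then obtain f u where "\<And>n. (f n, u n) \<in> S" "u \<longlonglongrightarrow> \<phi>" "(\<lambda>n. F (f n)) \<longlonglongrightarrow> e" by blast
  then show "(\<phi>, e) \<in> closure K"
    unfolding closure_sequential
    by (intro exI[of _ "\<lambda>n. (u n, F (f n))"]) (force simp: K_def intro: tendsto_Pair)
qed

text \<open>The limit defining the closure exists by continuity of \<open>C\<close>, and it is
  independent of the sequences because \<open>closure K\<close> is single valued.\<close>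

lemma form_closure_inverse:
  shows "fdom (form_closure (form_of_rel (S\<inverse>))) = Domain (closure K)"
    and "(\<phi>, e) \<in> closure K \<Longrightarrow> (\<psi>, d) \<in> closure K \<Longrightarrow>
      fval (form_closure (form_of_rel (S\<inverse>))) \<phi> \<psi> = cinner e (C d)"
proof -
  show "fdom (form_closure (form_of_rel (S\<inverse>))) = Domain (closure K)"
    unfolding form_closure_def form.sel set_eq_iff mem_Collect_eq Domain_iff
      form_converges_inverse_iff closure_K_iff by blast
  assume e: "(\<phi>, e) \<in> closure K" and d: "(\<psi>, d) \<in> closure K"
  have lim: "(\<lambda>n. fval (form_of_rel (S\<inverse>)) (u n) (v n)) \<longlonglongrightarrow> cinner e (C d)"
    if u: "form_converges (form_of_rel (S\<inverse>)) u \<phi>" and v: "form_converges (form_of_rel (S\<inverse>)) v \<psi>"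
    for u v
  proof -
    obtain f e' where f: "\<forall>n. (f n, u n) \<in> S" "u \<longlonglongrightarrow> \<phi>" "(\<lambda>n. F (f n)) \<longlonglongrightarrow> e'"
      using u by (auto simp: form_converges_inverse_iff)
    obtain g d' where g: "\<forall>n. (g n, v n) \<in> S" "v \<longlonglongrightarrow> \<psi>" "(\<lambda>n. F (g n)) \<longlonglongrightarrow> d'"
      using v by (auto simp: form_converges_inverse_iff)
    have "e' = e" using f by (intro closure_K_unique[OF _ e]) (auto simp: closure_K_iff)
    moreover have "d' = d" using g by (intro closure_K_unique[OF _ d]) (auto simp: closure_K_iff)
    moreover have "(\<lambda>n. cinner (F (f n)) (C (F (g n)))) \<longlonglongrightarrow> cinner e' (C d')"
      by (intro tendsto_cinner tendsto_C f g)
    moreover have "fval (form_of_rel (S\<inverse>)) (u n) (v n) = cinner (F (f n)) (C (F (g n)))" for n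
      using f(1) g(1) by (simp add: form_of_inverse)
    ultimately show ?thesis by simp
  qed
  have "\<exists>u. form_converges (form_of_rel (S\<inverse>)) u \<phi>" "\<exists>v. form_converges (form_of_rel (S\<inverse>)) v \<psi>"
    using e d by (auto simp: form_converges_inverse_iff closure_K_iff)
  then obtain u v where uv: "form_converges (form_of_rel (S\<inverse>)) u \<phi>"
    "form_converges (form_of_rel (S\<inverse>)) v \<psi>" by blast
  show "fval (form_closure (form_of_rel (S\<inverse>))) \<phi> \<psi> = cinner e (C d)"
    unfolding form_closure_def form.sel
  proof (rule the_equality)
    fix z assume "\<forall>u v. form_converges (form_of_rel (S\<inverse>)) u \<phi> \<and> form_converges (form_of_rel (S\<inverse>)) v \<psi> \<longrightarrow>
      (\<lambda>n. fval (form_of_rel (S\<inverse>)) (u n) (v n)) \<longlonglongrightarrow> z"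
    then show "z = cinner e (C d)" using lim[OF uv] uv LIMSEQ_unique by blast
  qed (use lim in blast)
qed

text \<open>The Friedrichs extension of the inverse is determined by
  \<open>(e, C d) = (h, \<psi>)\<close> for all \<open>(\<psi>, d)\<close> in
  \<open>closure K\<close>. By continuity it suffices to test this on \<open>K\<close>, which is the
  condition defining \<open>G\<close>.\<close>

lemma krein_ext_iff:
  "(h, \<phi>) \<in> krein_ext S \<longleftrightarrow> (\<exists>e. (\<phi>, e) \<in> closure K \<and> (h, e) \<in> G)"
proof -
  have *: "(h, e) \<in> G \<longleftrightarrow> (\<forall>(\<psi>, d)\<in>closure K. cinner e (C d) = cinner h \<psi>)" if e: "e \<in> E" for e
  proof
    assume "(h, e) \<in> G"
    then have "closure K \<subseteq> {x. cinner e (C (snd x)) = cinner h (fst x)}"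
      by (intro closure_minimal closed_Collect_eq continuous_intros
          bounded_linear.continuous_on[OF C(1)]) (auto simp: G_def K_def)
    then show "\<forall>(\<psi>, d)\<in>closure K. cinner e (C d) = cinner h \<psi>" by auto
  qed (use e K_subset in \<open>auto simp: G_def\<close>)
  have "(h, \<phi>) \<in> krein_ext S \<longleftrightarrow> \<phi> \<in> Domain (closure K) \<and>
      (\<forall>\<psi>\<in>Domain (closure K). fval (form_closure (form_of_rel (S\<inverse>))) \<phi> \<psi> = cinner h \<psi>)"
    by (simp add: krein_ext_def friedrichs_ext_def rel_of_form_def form_closure_inverse)
  also have "\<dots> \<longleftrightarrow> (\<exists>e. (\<phi>, e) \<in> closure K \<and> (\<forall>(\<psi>, d)\<in>closure K. cinner e (C d) = cinner h \<psi>))"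
  proof
    assume L: "\<phi> \<in> Domain (closure K) \<and>
      (\<forall>\<psi>\<in>Domain (closure K). fval (form_closure (form_of_rel (S\<inverse>))) \<phi> \<psi> = cinner h \<psi>)"
    then obtain e where e: "(\<phi>, e) \<in> closure K" by auto
    have "cinner e (C d) = cinner h \<psi>" if d: "(\<psi>, d) \<in> closure K" for \<psi> d
      using L form_closure_inverse(2)[OF e d] DomainI[OF d] by auto
    with e show "\<exists>e. (\<phi>, e) \<in> closure K \<and> (\<forall>(\<psi>, d)\<in>closure K. cinner e (C d) = cinner h \<psi>)"
      by auto
  qed (auto simp: form_closure_inverse)
  also have "\<dots> \<longleftrightarrow> (\<exists>e. (\<phi>, e) \<in> closure K \<and> (h, e) \<in> G)"
    using * closure_K_E by blast
  finally show ?thesis .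
qed

end

section \<open>The Krein form when the two closures agree\<close>

locale balanced_restriction = restricted_form +
  assumes E_eq: "closure (F ` Domain S) = closure ((\<lambda>f. C (F f)) ` Domain S)"
begin

lemma C_E: "x \<in> E \<Longrightarrow> C x \<in> E"
proof -
  have "closed (C -` E)"
    by (intro closed_vimage closed_E bounded_linear.continuous_on[OF C(1)] continuous_on_id)
  moreover have "F ` Domain S \<subseteq> C -` E"
    unfolding E_def E_eq using closure_subset by fastforce
  ultimately have "E \<subseteq> C -` E" unfolding E_def by (intro closure_minimal) auto
  then show "x \<in> E \<Longrightarrow> C x \<in> E" by auto
qed

lemma CF_in_E: "(g, g') \<in> S \<Longrightarrow> C (F g) \<in> E"
  by (intro C_E F_in_E)

text \<open>The difference of two values lies in \<open>E\<close> and is orthogonal to all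
  \<open>C (F g)\<close>, which are dense in \<open>E\<close> by \<open>E_eq\<close>.\<close>

lemma G_unique:
  assumes "(h, e) \<in> G" "(h, d) \<in> G"
  shows "e = d"
proof -
  have ed: "e - d \<in> E" using assms by (auto simp: G_def intro: csubspaceD csubspace_E)
  have "E \<subseteq> {x. cinner (e - d) x = 0}"
    unfolding E_def E_eq
    by (intro closure_minimal closed_Collect_eq continuous_intros)
      (auto simp: cinner_diff_left cinner_G[OF assms(1)] cinner_G[OF assms(2)])
  then have "cinner (e - d) (e - d) = 0" using ed by blast
  then show ?thesis by simp
qed

lemma app_G: "(h, e) \<in> G \<Longrightarrow> app_rel G h = e"
  unfolding app_rel_def using G_unique by (intro the_equality) auto

lemma csubspace_G: "csubspace G"
  unfolding csubspace_def G_def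
  by (auto simp: zero_prod_def scaleC_prod_def cinner_simps csubspaceD[OF csubspace_E]
      split: prod.splits; blast)

lemma closed_G: "closed G"
proof -
  have "G = (UNIV \<times> E) \<inter> (\<Inter>(g, g')\<in>S. {x. cinner (snd x) (C (F g)) = cinner (fst x) g'})"
    by (auto simp: G_def)
  also have "closed \<dots>"
    by (intro closed_Int closed_Times closed_UNIV closed_E closed_INT ballI)
      (auto intro!: closed_Collect_eq continuous_intros)
  finally show ?thesis .
qed

text \<open>\<open>G\<close> is the graph of a closed operator, so closedness, maximality and the
  core property hold for \<open>(C G h, G k)\<close> as well.\<close>

sublocale krein: factored_form "Domain G" "app_rel G" B
proof
  show "csubspace (Domain G)" by (rule csubspace_Domain[OF csubspace_G])
  have "(\<lambda>h. (h, app_rel G h)) ` Domain G = G"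
    by (auto simp: app_G image_iff Domain_iff)
  then show "closed ((\<lambda>h. (h, app_rel G h)) ` Domain G)" using closed_G by simp
  show "app_rel G (h + k) = app_rel G h + app_rel G k" if "h \<in> Domain G" "k \<in> Domain G" for h k
    using that csubspaceD(2)[OF csubspace_G] by (fastforce simp: app_G intro!: app_G)
  show "app_rel G (c *\<^sub>C h) = c *\<^sub>C app_rel G h" if "h \<in> Domain G" for c h
    using that csubspaceD(3)[OF csubspace_G] by (fastforce simp: app_G scaleC_prod_def intro!: app_G)
qed (rule B)

text \<open>\<open>G\<close> is the adjoint, formed in \<open>E\<close>, of the relation \<open>J\<close> in the proof.\<close>

lemma closure_K_iff_G:
  assumes e: "e \<in> E"
  shows "(\<phi>, e) \<in> closure K \<longleftrightarrow> (\<forall>(l, d)\<in>G. cinner (C e) d = cinner \<phi> l)"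
proof
  assume L: "(\<phi>, e) \<in> closure K"
  have "cinner (C e) d = cinner \<phi> l" if ld: "(l, d) \<in> G" for l d
  proof -
    have "cinner (C (F g)) d = cinner g' l" if "(g, g') \<in> S" for g g'
      using cinner_G[OF ld that] by (metis cinner_commute)
    then have "closure K \<subseteq> {x. cinner (C (snd x)) d = cinner (fst x) l}"
      by (intro closure_minimal closed_Collect_eq continuous_intros
          bounded_linear.continuous_on[OF C(1)]) (auto simp: K_def)
    then show ?thesis using L by auto
  qed
  then show "\<forall>(l, d)\<in>G. cinner (C e) d = cinner \<phi> l" by auto
next
  assume R: "\<forall>(l, d)\<in>G. cinner (C e) d = cinner \<phi> l"
  define J where "J = (\<lambda>x. (fst x, C (snd x))) ` K"
  have "csubspace J"
    unfolding J_def
    by (rule csubspace_linear_image[OF csubspace_K]) (simp_all add: C(2,4) scaleC_prod_def)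
  \<comment> \<open>Passing to the double complement replaces approximation in \<open>J\<close> by a
    test against vectors orthogonal to \<open>J\<close>.\<close>
  moreover have "(\<phi>, C e) \<in> orth_compl (orth_compl J)"
    unfolding orth_compl_def[of "orth_compl J"]
  proof safe
    fix y x assume "(y, x) \<in> orth_compl J"
    then have yx: "cinner y g' + cinner x (C (F g)) = 0" if "(g, g') \<in> S" for g g'
      using that by (force simp: orth_compl_def J_def K_def cinner_prod_def)
    obtain p where p: "p \<in> E" "x - p \<in> orth_compl E"
      using projection[OF csubspace_E closed_E] .
    \<comment> \<open>Only the component of \<open>x\<close> in \<open>E\<close> is seen by the
      vectors \<open>C (F g)\<close>; hence orthogonality to \<open>J\<close> says that
      \<open>(- y, p)\<close> belongs to \<open>G\<close>.\<close>
    have "cinner p (C (F g)) = cinner (- y) g'" if "(g, g') \<in> S" for g g'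
      using orth_complD(1)[OF p(2) CF_in_E[OF that]] yx[OF that]
      by (simp add: cinner_simps eq_neg_iff_add_eq_0 add.commute)
    then have "(- y, p) \<in> G" using p(1) by (auto simp: G_def)
    then have "cinner (C e) p = cinner \<phi> (- y)" using R by blast
    then show "cinner (\<phi>, C e) (y, x) = 0"
      using orth_complD(2)[OF p(2) C_E[OF e]] by (simp add: cinner_prod_def cinner_simps add.commute)
  qed
  ultimately have "(\<phi>, C e) \<in> closure J" by (simp add: orth_compl_orth_compl)
  then obtain z where z: "\<forall>n. z n \<in> J" "z \<longlonglongrightarrow> (\<phi>, C e)" by (auto simp: closure_sequential)
  then have "\<forall>n. \<exists>x. x \<in> K \<and> z n = (fst x, C (snd x))" unfolding J_def by blast
  then obtain x where x: "\<And>n. x n \<in> K" "\<And>n. z n = (fst (x n), C (snd (x n)))" by metis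
  have x1: "(\<lambda>n. fst (x n)) \<longlonglongrightarrow> \<phi>" and x2: "(\<lambda>n. C (snd (x n))) \<longlonglongrightarrow> C e"
    using tendsto_fst[OF z(2)] tendsto_snd[OF z(2)] by (simp_all add: x(2))
  have "(\<lambda>n. C (snd (x n)) - C e) \<longlonglongrightarrow> 0" using LIM_zero[OF x2] .
  \<comment> \<open>The norm of \<open>C x\<close> dominates that of \<open>x\<close>, so
    convergence of the images gives convergence of the vectors.\<close>
  then have "(\<lambda>n. snd (x n) - e) \<longlonglongrightarrow> 0"
    by (rule Lim_null_comparison[rotated, OF tendsto_norm_zero])
      (auto intro!: always_eventually simp: norm_C_ge simp flip: C(3))
  then have "(\<lambda>n. snd (x n)) \<longlonglongrightarrow> e" by (rule LIM_zero_cancel)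
  with x1 have "(\<lambda>n. (fst (x n), snd (x n))) \<longlonglongrightarrow> (\<phi>, e)" by (rule tendsto_Pair)
  then show "(\<phi>, e) \<in> closure K" using x(1) by (auto simp: closure_sequential)
qed

lemma krein_ext_eq: "krein_ext S = rel_of_form krein.q"
proof -
  have "(h, \<phi>) \<in> krein_ext S \<longleftrightarrow> (h, \<phi>) \<in> rel_of_form krein.q" for h \<phi>
  proof -
    have "(h, \<phi>) \<in> krein_ext S \<longleftrightarrow> (\<exists>e. (h, e) \<in> G \<and> (\<forall>(l, d)\<in>G. cinner (C e) d = cinner \<phi> l))"
      unfolding krein_ext_iff using closure_K_iff_G by (auto simp: G_def)
    also have "\<dots> \<longleftrightarrow> (h, \<phi>) \<in> rel_of_form krein.q"
    proof
      assume "\<exists>e. (h, e) \<in> G \<and> (\<forall>(l, d)\<in>G. cinner (C e) d = cinner \<phi> l)"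
      then show "(h, \<phi>) \<in> rel_of_form krein.q"
        unfolding krein.rel_q_iff by (auto simp: app_G)
    next
      assume R: "(h, \<phi>) \<in> rel_of_form krein.q"
      then obtain e where e: "(h, e) \<in> G" by (auto simp: krein.rel_q_iff)
      have "cinner (C e) d = cinner \<phi> l" if ld: "(l, d) \<in> G" for l d
        using R app_G[OF e] app_G[OF ld] DomainI[OF ld] by (auto simp: krein.rel_q_iff)
      with e show "\<exists>e. (h, e) \<in> G \<and> (\<forall>(l, d)\<in>G. cinner (C e) d = cinner \<phi> l)" by auto
    qed
    finally show ?thesis .
  qed
  then show ?thesis by auto
qed

text \<open>On \<open>D\<close> the operator of the Krein extension is the compression of \<open>F\<close> to \<open>E\<close>.\<close>

lemma in_G_if_projection:
  assumes h: "h \<in> D" and p: "p \<in> E" "F h - p \<in> orth_compl E"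
  shows "(h, p) \<in> G"
proof -
  have "cinner p (C (F g)) = cinner h g'" if "(g, g') \<in> S" for g g'
    using orth_complD(1)[OF p(2) CF_in_E[OF that]] cinner_S'[OF that h]
    by (simp add: cinner_diff_left)
  with p(1) show ?thesis by (auto simp: G_def)
qed

theorem extremal_ext_iff:
  "extremal_ext S (rel_of_form q) \<longleftrightarrow> closure (F ` Domain S) = closure (F ` D)"
proof
  assume "extremal_ext S (rel_of_form q)"
  then obtain t k where t: "corresponds t (rel_of_form q)"
    and k: "corresponds k (rel_of_form krein.q)" and tk: "form_restriction t k"
    by (auto simp: extremal_ext_def krein_ext_eq)
  have "F h \<in> E" if h: "h \<in> D" for h
  proof -
    obtain p where p: "p \<in> E" "F h - p \<in> orth_compl E"
      using projection[OF csubspace_E closed_E] .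
    note hp = in_G_if_projection[OF h p]
    have "(norm (F h))\<^sup>2 = Re (fval t h h)"
      using corresponding_form_extends[OF t h] by simp
    also have "fval t h h = fval k h h"
      using tk corresponding_form_extends(1)[OF t h] by (auto simp: form_restriction_def)
    also have "Re (fval k h h) = (norm p)\<^sup>2"
      using krein.corresponding_form_extends(2)[OF k, of h] hp by (auto simp: app_G)
    finally have "(norm (F h))\<^sup>2 = (norm p)\<^sup>2" .
    \<comment> \<open>By Pythagoras, a vector whose norm equals that of its projection coincides
      with the projection.\<close>
    moreover have "inner (F h - p) p = 0"
      using orth_complD(1)[OF p(2,1)] by (simp flip: Re_cinner)
    ultimately have "(norm (F h - p))\<^sup>2 = 0"
      unfolding power2_norm_eq_inner by (simp add: inner_simps inner_commute)
    then show ?thesis using p(1) by simp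
  qed
  then have "closure (F ` D) \<subseteq> E" by (intro closure_minimal closed_E) auto
  then show "closure (F ` Domain S) = closure (F ` D)"
    using closure_mono[OF image_mono[OF Domain_S(2)]] unfolding E_def by blast
next
  assume eq: "closure (F ` Domain S) = closure (F ` D)"
  \<comment> \<open>Here \<open>F h\<close> lies in \<open>E\<close> and is its own projection, so
    \<open>G\<close> extends the graph of \<open>F\<close>.\<close>
  have hG: "(h, F h) \<in> G" if h: "h \<in> D" for h
  proof (rule in_G_if_projection[OF h])
    show "F h \<in> E" using h closure_subset[of "F ` D"] by (auto simp: E_def eq)
  qed (simp add: orth_compl_def)
  have "form_restriction q krein.q"
    using hG by (auto simp: form_restriction_def app_G[OF hG])
  moreover have "sectorial S"
    using sectorial_rel_q csubspace_S S_subset by (fastforce simp: sectorial_def)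
  ultimately show "extremal_ext S (rel_of_form q)"
    unfolding extremal_ext_def krein_ext_eq
    using maximal_sectorial_rel_q S_subset corresponds_q krein.corresponds_q by blast
qed

end


section \<open>The sum of two maximal sectorial relations\<close>

locale sectorial_decomposition =
  fixes H :: "('a::complex_hilbert \<times> 'a) set" and t :: "'a form"
    and A R :: "('a \<times> 'a) set" and B :: "'a \<Rightarrow> 'a"
  assumes data: "sectorial_data H t A R B"
begin

definition M :: "'a set" where
  "M = mul_rel A"

definition Q :: "('a \<times> 'a) set" where
  "Q = oplus_mul R A"

lemma H_eq: "H = rel_of_form t" and B: "bounded_selfadjoint B"
  and csubspace_A: "csubspace A" and adjoint_A: "adjoint_rel A = A"
  using data
  unfolding sectorial_data_def corresponds_def nonneg_selfadjoint_in_def UNIV_Times_UNIV Int_UNIV_right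
  by blast+

text \<open>A pair \<open>(0, m)\<close> lies in the adjoint exactly when \<open>m\<close> is
  orthogonal to the domain, and \<open>A\<close> is its own adjoint.\<close>

lemma M_eq: "M = orth_compl (Domain A)"
  unfolding M_def mul_rel_def
  by (subst adjoint_A[symmetric]) (auto simp: adjoint_rel_def orth_compl_def)

lemma csubspace_M: "csubspace M" and closed_M: "closed M"
  by (simp_all add: M_eq csubspace_orth_compl closed_orth_compl)

lemma csubspace_R: "csubspace R" and R_subset: "R \<subseteq> orth_compl M \<times> orth_compl M"
  and adjoint_R: "adjoint_rel R \<inter> orth_compl M \<times> orth_compl M = R"
  and single_valued_R: "single_valued R"
  using data
  unfolding sectorial_data_def is_nonneg_sqrt_in_def nonneg_selfadjoint_in_def M_def
  by blast+

lemma closed_R: "closed R"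
  by (subst adjoint_R[symmetric])
    (intro closed_Int closed_adjoint_rel closed_Times closed_orth_compl)

lemma app_R: "(f, g) \<in> R \<Longrightarrow> app_rel R f = g"
  unfolding app_rel_def using single_valued_R by (auto simp: single_valued_def)

lemma app_R_in: "h \<in> Domain R \<Longrightarrow> (h, app_rel R h) \<in> R"
  by (auto simp: app_R)

lemma zero_M: "0 \<in> M" and zero_R: "(0, 0) \<in> R"
  using csubspaceD(1)[OF csubspace_M] csubspaceD(1)[OF csubspace_R] by (simp_all add: zero_prod_def)

lemma Q_iff: "(h, k) \<in> Q \<longleftrightarrow> (\<exists>g m. (h, g) \<in> R \<and> m \<in> M \<and> k = g + m)"
  by (auto simp: Q_def oplus_mul_def M_def)

lemma Q_E:
  assumes "(h, k) \<in> Q"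
  obtains m where "h \<in> Domain R" "m \<in> M" "k = app_rel R h + m"
proof -
  obtain g m where "(h, g) \<in> R" "m \<in> M" "k = g + m" using assms by (auto simp: Q_iff)
  then show ?thesis using that[of m] app_R by blast
qed

lemma Domain_Q: "Domain Q = Domain R"
  unfolding Domain_iff Q_iff set_eq_iff using zero_M by blast

lemma R_Q: "(h, k) \<in> R \<Longrightarrow> (h, k) \<in> Q" and M_Q: "m \<in> M \<Longrightarrow> (0, m) \<in> Q"
  using zero_M zero_R by (force simp: Q_iff)+

lemma fdom_t: "fdom t = Domain R"
  and fval_t: "h \<in> Domain R \<Longrightarrow> k \<in> Domain R \<Longrightarrow>
    fval t h k = cinner (app_rel R h + \<i> *\<^sub>C B (app_rel R h)) (app_rel R k)"
  using data Domain_Q unfolding sectorial_data_def Q_def by auto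

lemma B_M: "m \<in> M \<Longrightarrow> B m = 0"
proof -
  assume m: "m \<in> M"
  have "0 \<in> ker_rel A" using csubspaceD(1)[OF csubspace_A] by (simp add: ker_rel_def zero_prod_def)
  then have "B (0 + m) = 0" using data m unfolding sectorial_data_def M_def by blast
  then show ?thesis by simp
qed

text \<open>\<open>B\<close> is selfadjoint and vanishes on \<open>M\<close>, so its range is
  orthogonal to \<open>M\<close>, as are the values of \<open>R\<close>.\<close>

lemma id_plus_i_perp:
  assumes "h \<in> Domain R"
  shows "app_rel R h + \<i> *\<^sub>C B (app_rel R h) \<in> orth_compl M"
proof -
  have "B x \<in> orth_compl M" for x
    using bounded_selfadjointD(2)[OF B] by (simp add: orth_compl_def B_M)
  then show ?thesis
    using app_R_in[OF assms] R_subset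
    by (auto intro!: csubspaceD(2,3)[OF csubspace_orth_compl])
qed

text \<open>Testing with \<open>(0, m)\<close> shows that \<open>k\<close> is orthogonal to
  \<open>M\<close>. After removal of its component in \<open>M\<close>, the vector \<open>h\<close>
  is a value of the adjoint of \<open>R\<close> formed in the complement of \<open>M\<close>, which
  is \<open>R\<close>.\<close>

lemma adjoint_Q: "adjoint_rel Q = Q"
proof -
  have "(k, h) \<in> Q" if kh: "(k, h) \<in> adjoint_rel Q" for k h
  proof -
    have adj: "cinner k f' = cinner h f" if "(f, f') \<in> Q" for f f'
      using kh that by (auto simp: adjoint_rel_def)
    have k: "k \<in> orth_compl M"
      using adj[OF M_Q] by (simp add: orth_compl_def)
    obtain p where p: "p \<in> M" "h - p \<in> orth_compl M"
      using projection[OF csubspace_M closed_M] .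
    have "cinner k f' = cinner (h - p) f" if "(f, f') \<in> R" for f f'
      using adj[OF R_Q[OF that]] orth_complD(2)[OF _ p(1), of f] R_subset that
      by (auto simp: cinner_diff_left)
    then have "(k, h - p) \<in> R"
      using k p(2) by (subst adjoint_R[symmetric]) (auto simp: adjoint_rel_def)
    with p(1) show ?thesis by (force simp: Q_iff)
  qed
  moreover have "(k, h) \<in> adjoint_rel Q" if kh: "(k, h) \<in> Q" for k h
  proof -
    obtain g m where g: "(k, g) \<in> R" "m \<in> M" "h = g + m" using kh by (auto simp: Q_iff)
    have "cinner k f' = cinner h f" if ff': "(f, f') \<in> Q" for f f'
    proof -
      obtain g' m' where g': "(f, g') \<in> R" "m' \<in> M" "f' = g' + m'" using ff' by (auto simp: Q_iff)
      have "(k, g) \<in> adjoint_rel R" using g(1) adjoint_R by blast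
      then have "cinner k g' = cinner g f" using g'(1) by (auto simp: adjoint_rel_def)
      moreover have "cinner k m' = 0" "cinner m f = 0"
        using orth_complD[of k M m'] orth_complD[of f M m] R_subset g g' by auto
      ultimately show ?thesis by (simp add: g g' cinner_simps)
    qed
    then show ?thesis by (auto simp: adjoint_rel_def)
  qed
  ultimately show ?thesis by auto
qed

end

section \<open>The column operator \<open>F\<close> and the relation \<open>\<Phi>\<close> of a
  pair\<close>

locale sectorial_pair =
  one: sectorial_decomposition H1 t1 A1 R1 B1 + two: sectorial_decomposition H2 t2 A2 R2 B2
  for H1 H2 :: "('a::complex_hilbert \<times> 'a) set" and t1 t2 A1 A2 R1 R2 B1 B2
begin

definition F :: "'a \<Rightarrow> 'a \<times> 'a" where
  "F h = (app_rel R1 h, app_rel R2 h)"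

definition \<Phi> :: "(('a \<times> 'a) \<times> 'a) set" where
  "\<Phi> = {((f1, f2), f1' + f2') | f1 f2 f1' f2'. (f1, f1') \<in> one.Q \<and> (f2, f2') \<in> two.Q}"

sublocale factored_form "Domain R1 \<inter> Domain R2" F "map_prod B1 B2"
proof
  note D1 = csubspace_Domain[OF one.csubspace_R] and D2 = csubspace_Domain[OF two.csubspace_R]
  show "csubspace (Domain R1 \<inter> Domain R2)"
    using D1 D2 by (auto simp: csubspace_def)
  have add: "app_rel R1 (h + k) = app_rel R1 h + app_rel R1 k"
    if "h \<in> Domain R1" "k \<in> Domain R1" for h k
    using csubspaceD(2)[OF one.csubspace_R one.app_R_in one.app_R_in] that
    by (auto intro: one.app_R)
  have add': "app_rel R2 (h + k) = app_rel R2 h + app_rel R2 k"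
    if "h \<in> Domain R2" "k \<in> Domain R2" for h k
    using csubspaceD(2)[OF two.csubspace_R two.app_R_in two.app_R_in] that
    by (auto intro: two.app_R)
  have scale: "app_rel R1 (c *\<^sub>C h) = c *\<^sub>C app_rel R1 h" if "h \<in> Domain R1" for c h
    using csubspaceD(3)[OF one.csubspace_R one.app_R_in] that
    by (auto simp: scaleC_prod_def intro: one.app_R)
  have scale': "app_rel R2 (c *\<^sub>C h) = c *\<^sub>C app_rel R2 h" if "h \<in> Domain R2" for c h
    using csubspaceD(3)[OF two.csubspace_R two.app_R_in] that
    by (auto simp: scaleC_prod_def intro: two.app_R)
  show "F (h + k) = F h + F k"
    if "h \<in> Domain R1 \<inter> Domain R2" "k \<in> Domain R1 \<inter> Domain R2" for h k
    using that add add' by (simp add: F_def)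
  show "F (c *\<^sub>C h) = c *\<^sub>C F h" if "h \<in> Domain R1 \<inter> Domain R2" for c h
    using that scale scale' by (simp add: F_def scaleC_prod_def)
  have "(\<lambda>h. (h, F h)) ` (Domain R1 \<inter> Domain R2)
      = (\<lambda>x. (fst x, fst (snd x))) -` R1 \<inter> (\<lambda>x. (fst x, snd (snd x))) -` R2"
    by (auto simp: F_def one.app_R two.app_R image_iff)
  also have "closed \<dots>"
    by (intro closed_Int closed_vimage one.closed_R two.closed_R continuous_intros)
  finally show "closed ((\<lambda>h. (h, F h)) ` (Domain R1 \<inter> Domain R2))" .
  show "bounded_selfadjoint (map_prod B1 B2)"
    by (rule bounded_selfadjoint_map_prod[OF one.B two.B])
qed

lemma C_pair: "C (x, y) = (x + \<i> *\<^sub>C B1 x, y + \<i> *\<^sub>C B2 y)"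
  by (simp add: C_def scaleC_prod_def)

text \<open>Taking one of the two pairs to be \<open>(0, 0)\<close> separates the adjoint condition
  into one for each \<open>Q\<close>, and each \<open>Q\<close> is selfadjoint.\<close>

lemma adjoint_Phi_iff: "(h, (k1, k2)) \<in> adjoint_rel \<Phi> \<longleftrightarrow> (h, k1) \<in> one.Q \<and> (h, k2) \<in> two.Q"
proof
  assume L: "(h, (k1, k2)) \<in> adjoint_rel \<Phi>"
  have *: "cinner h (f1' + f2') = cinner k1 f1 + cinner k2 f2"
    if "(f1, f1') \<in> one.Q" "(f2, f2') \<in> two.Q" for f1 f2 f1' f2'
  proof -
    have "((f1, f2), f1' + f2') \<in> \<Phi>" using that by (auto simp: \<Phi>_def)
    then show ?thesis using L by (fastforce simp: adjoint_rel_def cinner_prod_def)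
  qed
  have "(h, k1) \<in> adjoint_rel one.Q" "(h, k2) \<in> adjoint_rel two.Q"
    using *[OF _ two.M_Q[OF two.zero_M]] *[OF one.M_Q[OF one.zero_M]]
    by (auto simp: adjoint_rel_def)
  then show "(h, k1) \<in> one.Q \<and> (h, k2) \<in> two.Q"
    by (simp add: one.adjoint_Q two.adjoint_Q)
next
  assume "(h, k1) \<in> one.Q \<and> (h, k2) \<in> two.Q"
  then have "(h, k1) \<in> adjoint_rel one.Q" "(h, k2) \<in> adjoint_rel two.Q"
    by (simp_all add: one.adjoint_Q two.adjoint_Q)
  then have "cinner h f1' = cinner k1 f1" "cinner h f2' = cinner k2 f2"
    if "(f1, f1') \<in> one.Q" "(f2, f2') \<in> two.Q" for f1 f2 f1' f2'
    using that by (auto simp: adjoint_rel_def)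
  then show "(h, (k1, k2)) \<in> adjoint_rel \<Phi>"
    by (auto simp: adjoint_rel_def \<Phi>_def cinner_prod_def cinner_simps)
qed

text \<open>Elements of the adjoint of \<open>\<Phi>\<close> may carry multivalued parts
  \<open>m1\<close>, \<open>m2\<close>; the biadjoint condition eliminates them and reduces to the
  identity that defines the relation of \<open>q\<close>.\<close>

lemma rel_of_form_q_eq:
  "rel_of_form q = prod_rel (adjoint_rel (adjoint_rel \<Phi>))
      (prod_rel (graph_of (\<lambda>x. x + \<i> *\<^sub>C map_prod B1 B2 x)) (adjoint_rel \<Phi>))"
  (is "_ = ?P")
proof -
  have P_iff: "(h, \<phi>) \<in> ?P \<longleftrightarrow> (\<exists>k1 k2. (h, (k1, k2)) \<in> adjoint_rel \<Phi> \<and>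
      (C (k1, k2), \<phi>) \<in> adjoint_rel (adjoint_rel \<Phi>))" for h \<phi>
    unfolding prod_rel_def graph_of_def C_def[symmetric] relcomp_unfold by fastforce
  have bi: "(g, \<phi>) \<in> adjoint_rel (adjoint_rel \<Phi>) \<longleftrightarrow>
      (\<forall>l a1 a2. (l, a1) \<in> one.Q \<and> (l, a2) \<in> two.Q \<longrightarrow>
        cinner (fst g) a1 + cinner (snd g) a2 = cinner \<phi> l)" for g \<phi>
    unfolding adjoint_rel_def[of "adjoint_rel \<Phi>"] adjoint_Phi_iff[symmetric]
    by (fastforce simp: cinner_prod_def)
  have "(h, \<phi>) \<in> rel_of_form q" if hP: "(h, \<phi>) \<in> ?P" for h \<phi>
  proof -
    obtain k1 k2 where k: "(h, k1) \<in> one.Q" "(h, k2) \<in> two.Q"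
      and adj: "\<And>l a1 a2. (l, a1) \<in> one.Q \<Longrightarrow> (l, a2) \<in> two.Q \<Longrightarrow>
        cinner (fst (C (k1, k2))) a1 + cinner (snd (C (k1, k2))) a2 = cinner \<phi> l"
      using hP unfolding P_iff adjoint_Phi_iff bi by blast
    obtain m1 where m1: "h \<in> Domain R1" "m1 \<in> one.M" "k1 = app_rel R1 h + m1"
      by (rule one.Q_E[OF k(1)])
    obtain m2 where m2: "h \<in> Domain R2" "m2 \<in> two.M" "k2 = app_rel R2 h + m2"
      by (rule two.Q_E[OF k(2)])
    have C1: "fst (C (k1, k2)) = (app_rel R1 h + \<i> *\<^sub>C B1 (app_rel R1 h)) + m1"
      and C2: "snd (C (k1, k2)) = (app_rel R2 h + \<i> *\<^sub>C B2 (app_rel R2 h)) + m2"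
      using bounded_clinearD(2)[OF bounded_selfadjointD(1)[OF one.B]]
        bounded_clinearD(2)[OF bounded_selfadjointD(1)[OF two.B]]
      by (simp_all add: C_pair m1 m2 one.B_M two.B_M)
    \<comment> \<open>The test vectors are \<open>(m1, 0)\<close> and \<open>(0, m2)\<close> over
      \<open>l = 0\<close>; since \<open>B1\<close> and \<open>B2\<close> vanish on the multivalued
      parts, \<open>C\<close> leaves \<open>m1\<close> and \<open>m2\<close> unchanged.\<close>
    have "cinner (fst (C (k1, k2))) m1 = 0" "cinner (snd (C (k1, k2))) m2 = 0"
      using adj[OF one.M_Q[OF m1(2)] two.M_Q[OF two.zero_M]]
        adj[OF one.M_Q[OF one.zero_M] two.M_Q[OF m2(2)]] by simp_all
    then have "m1 = 0" "m2 = 0"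
      using orth_complD(1)[OF one.id_plus_i_perp[OF m1(1)] m1(2)]
        orth_complD(1)[OF two.id_plus_i_perp[OF m2(1)] m2(2)]
      unfolding C1 C2 cinner_add_left[of _ m1] cinner_add_left[of _ m2] by simp_all
    then have Fh: "(k1, k2) = F h" by (simp add: F_def m1 m2)
    have "cinner (C (F h)) (F k) = cinner \<phi> k" if "k \<in> Domain R1 \<inter> Domain R2" for k
      using adj[OF one.R_Q[OF one.app_R_in] two.R_Q[OF two.app_R_in], of k] that
      unfolding Fh by (simp add: cinner_prod_def F_def)
    then show ?thesis using m1(1) m2(1) by (simp add: rel_q_iff)
  qed
  moreover have "(h, \<phi>) \<in> ?P" if h: "(h, \<phi>) \<in> rel_of_form q" for h \<phi>
  proof -
    have hD: "h \<in> Domain R1" "h \<in> Domain R2" using h by (auto simp: rel_q_iff)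
    have "cinner (fst (C (F h))) a1 + cinner (snd (C (F h))) a2 = cinner \<phi> l"
      if Q: "(l, a1) \<in> one.Q" "(l, a2) \<in> two.Q" for l a1 a2
    proof -
      obtain m1 where m1: "l \<in> Domain R1" "m1 \<in> one.M" "a1 = app_rel R1 l + m1"
        by (rule one.Q_E[OF Q(1)])
      obtain m2 where m2: "l \<in> Domain R2" "m2 \<in> two.M" "a2 = app_rel R2 l + m2"
        by (rule two.Q_E[OF Q(2)])
      have "cinner (C (F h)) (F l) = cinner \<phi> l" using h m1 m2 by (auto simp: rel_q_iff)
      moreover have "cinner (fst (C (F h))) m1 = 0" "cinner (snd (C (F h))) m2 = 0"
        using orth_complD(1)[OF one.id_plus_i_perp[OF hD(1)] m1(2)]
          orth_complD(1)[OF two.id_plus_i_perp[OF hD(2)] m2(2)]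
        unfolding F_def C_pair fst_conv snd_conv .
      ultimately show ?thesis
        by (simp add: m1 m2 cinner_add_right cinner_prod_def) (simp add: F_def)
    qed
    then have "(C (F h), \<phi>) \<in> adjoint_rel (adjoint_rel \<Phi>)" by (simp add: bi)
    moreover have "(h, (app_rel R1 h, app_rel R2 h)) \<in> adjoint_rel \<Phi>"
      using hD by (simp add: adjoint_Phi_iff one.R_Q[OF one.app_R_in] two.R_Q[OF two.app_R_in])
    ultimately show ?thesis unfolding P_iff F_def by blast
  qed
  ultimately show ?thesis by auto
qed

lemma sum_rel_subset: "sum_rel H1 H2 \<subseteq> rel_of_form q"
proof -
  have "(f, g + h) \<in> rel_of_form q" if "(f, g) \<in> H1" "(f, h) \<in> H2" for f g h
  proof -
    have f: "f \<in> Domain R1" "f \<in> Domain R2"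
      using that by (simp_all add: one.H_eq two.H_eq rel_of_form_def one.fdom_t two.fdom_t)
    have g: "fval t1 f k = cinner g k" if "k \<in> Domain R1" for k
      using \<open>(f, g) \<in> H1\<close> that by (auto simp: one.H_eq rel_of_form_def one.fdom_t)
    have h: "fval t2 f k = cinner h k" if "k \<in> Domain R2" for k
      using \<open>(f, h) \<in> H2\<close> that by (auto simp: two.H_eq rel_of_form_def two.fdom_t)
    show ?thesis
      using one.fval_t[OF f(1)] two.fval_t[OF f(2)] f g h
      by (simp add: rel_q_iff F_def C_pair cinner_prod_def cinner_add_left[of g])
  qed
  then show ?thesis by (auto simp: sum_rel_def)
qed

end

section \<open>Transfer of the abstract results to the given pair\<close>

theorem theorem3p5:
  fixes H1 H2 A1 A2 R1 R2 Q1 Q2 :: "('a::complex_hilbert \<times> 'a) set"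
    and t1 t2 :: "'a form"
    and B1 B2 :: "'a \<Rightarrow> 'a"
    and \<Phi> :: "(('a \<times> 'a) \<times> 'a) set"
    and P :: "('a \<times> 'a) set"
    and E0 D0 F0 :: "('a \<times> 'a) set"
  assumes "maximal_sectorial H1" and "maximal_sectorial H2"
    and "sectorial_data H1 t1 A1 R1 B1" and "sectorial_data H2 t2 A2 R2 B2"
    and Q1: "Q1 = oplus_mul R1 A1" and Q2: "Q2 = oplus_mul R2 A2"
    and Phi: "\<Phi> = {((f1, f2), f1' + f2') | f1 f2 f1' f2'. (f1, f1') \<in> Q1 \<and> (f2, f2') \<in> Q2}"
    and P: "P = prod_rel (adjoint_rel (adjoint_rel \<Phi>))
                  (prod_rel (graph_of (\<lambda>x. x + \<i> *\<^sub>C map_prod B1 B2 x)) (adjoint_rel \<Phi>))"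
    and E0: "E0 = {(app_rel R1 f, app_rel R2 f) | f. f \<in> Domain H1 \<inter> Domain H2}"
    and D0: "D0 = {(app_rel R1 f + \<i> *\<^sub>C B1 (app_rel R1 f),
                    app_rel R2 f + \<i> *\<^sub>C B2 (app_rel R2 f)) | f. f \<in> Domain H1 \<inter> Domain H2}"
    and F0: "F0 = {(app_rel R1 h, app_rel R2 h) | h. h \<in> Domain Q1 \<inter> Domain Q2}"
  shows "(maximal_sectorial P \<and> sum_rel H1 H2 \<subseteq> P \<and>
           corresponds
             (Form (Domain Q1 \<inter> Domain Q2)
               (\<lambda>h k. cinner (app_rel R1 h + \<i> *\<^sub>C B1 (app_rel R1 h)) (app_rel R1 k)
                    + cinner (app_rel R2 h + \<i> *\<^sub>C B2 (app_rel R2 h)) (app_rel R2 k)))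
             P) \<and>
         (closure E0 = closure D0 \<longrightarrow>
           (extremal_ext (sum_rel H1 H2) P \<longleftrightarrow> closure E0 = closure F0))"
proof -
  interpret pair: sectorial_pair H1 H2 t1 t2 A1 A2 R1 R2 B1 B2
    by unfold_locales fact+
  have Q: "pair.one.Q = Q1" "pair.two.Q = Q2"
    by (simp_all add: pair.one.Q_def pair.two.Q_def Q1 Q2)
  have "pair.\<Phi> = \<Phi>" by (simp add: pair.\<Phi>_def Phi Q)
  then have P_eq: "P = rel_of_form pair.q" by (simp add: pair.rel_of_form_q_eq P)
  have Dom: "Domain Q1 \<inter> Domain Q2 = Domain R1 \<inter> Domain R2"
    by (simp add: pair.one.Domain_Q pair.two.Domain_Q flip: Q)
  have q_eq: "Form (Domain Q1 \<inter> Domain Q2)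
      (\<lambda>h k. cinner (app_rel R1 h + \<i> *\<^sub>C B1 (app_rel R1 h)) (app_rel R1 k)
           + cinner (app_rel R2 h + \<i> *\<^sub>C B2 (app_rel R2 h)) (app_rel R2 k)) = pair.q"
    by (simp add: pair.q_def Dom pair.F_def pair.C_pair cinner_prod_def)
  have "csubspace H1" "csubspace H2"
    using assms(1,2) by (simp_all add: maximal_sectorial_def sectorial_def)
  note S = csubspace_sum_rel[OF this]
  have "E0 = pair.F ` Domain (sum_rel H1 H2)" "F0 = pair.F ` (Domain R1 \<inter> Domain R2)"
    "D0 = (\<lambda>f. pair.C (pair.F f)) ` Domain (sum_rel H1 H2)"
    by (auto simp: E0 F0 D0 Dom Domain_sum_rel pair.F_def pair.C_pair)
  moreover have "extremal_ext (sum_rel H1 H2) (rel_of_form pair.q) \<longleftrightarrow>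
      closure (pair.F ` Domain (sum_rel H1 H2)) = closure (pair.F ` (Domain R1 \<inter> Domain R2))"
    if "closure (pair.F ` Domain (sum_rel H1 H2))
      = closure ((\<lambda>f. pair.C (pair.F f)) ` Domain (sum_rel H1 H2))"
  proof -
    \<comment> \<open>The equality of the closures of \<open>E0\<close> and \<open>D0\<close>
      becomes the locale assumption \<open>E_eq\<close>.\<close>
    interpret balanced_restriction "Domain R1 \<inter> Domain R2" pair.F "map_prod B1 B2" "sum_rel H1 H2"
      by unfold_locales (fact S pair.sum_rel_subset that)+
    show ?thesis by (rule extremal_ext_iff)
  qed
  ultimately show ?thesis
    unfolding q_eq P_eq
    using pair.maximal_sectorial_rel_q pair.sum_rel_subset pair.corresponds_q by blast
qed

end
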